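(* Let $n\ge 1$. For every $r\ge 0$, the transitive power $\mathsf{T}X_n^r$ is contained in the centre $Z(n)$ of $\mathbb{C}\mathfrak{S}_n$. Moreover, the resolution of $\mathsf{T}X_n^r$ with respect to the class basis $\{\mathsf{K}_\alpha : \alpha\vdash n\}$ of $Z(n)$ is $$\mathsf{T}X_n^r=\sum_{\substack{\alpha\vdash n,\ g\ge 0\\ n+m-2+2g=r}} a_g(\alpha)\,\mathsf{K}_\alpha ,\qquad m=l(\alpha),$$ where $a_g(\alpha)$ is a polynomial in the parts of $\alpha=(\alpha_1,\ldots,\alpha_m)$ given by $$a_g(\alpha)=\frac{(n+m-2+2g)!}{n!}\,\alpha_1\cdots\alpha_m\,Q_g(\alpha),\qquad Q_g(\alpha)=\sum_{\beta\vdash g}\frac{\xi_{2\beta}\,q_{2\beta}(\alpha)}{|\mathrm{Aut}\,\beta|},\qquad g\ge 0 .$$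
   Context: $\mathfrak{S}_n$ is the symmetric group on $[n]=\{1,\ldots,n\}$, and $Z(n)$ is the centre of the group algebra $\mathbb{C}\mathfrak{S}_n$. The Young-Jucys-Murphy element is $X_n=(1\,n)+(2\,n)+\cdots+(n-1\,n)\in\mathbb{C}\mathfrak{S}_n$, with $X_1=0$. The operator $\mathsf{T}$ is applied linearly to formal products of permutations: $\mathsf{T}(\sigma_1\cdots\sigma_r)=\sigma_1\cdots\sigma_r$ if the group generated by $\sigma_1,\ldots,\sigma_r$ acts transitively on $[n]$, and $\mathsf{T}(\sigma_1\cdots\sigma_r)=0$ otherwise. Thus $$\mathsf{T}X_n^r=\sum (i_1\,n)(i_2\,n)\cdots(i_r\,n)\in\mathbb{C}\mathfrak{S}_n,$$ summed over all $(i_1,\ldots,i_r)\in[n-1]^r$ such that the group generated by $(i_1\,n),\ldots,(i_r\,n)$ acts transitively on $[n]$ (for $r=0$ there is one, empty, product, equal to the identity, and it generates the trivial group, which is transitive on $[n]$ only if $n=1$). A partition $\alpha=(\alpha_1,\ldots,\alpha_m)$ of $n$ (written $\alpha\vdash n$) is a sequence of positive integers $\alpha_1\le\cdots\le\alpha_m$ with sum $n$; $l(\alpha)=m$ is its number of parts; the empty partition is the only partition of $0$. $\mathcal{K}_\alpha$ is the conjugacy class of $\mathfrak{S}_n$ of permutations with cycle type $\alpha$, and $\mathsf{K}_\alpha=\sum_{\pi\in\mathcal{K}_\alpha}\pi$. If $\beta$ has $f_j$ parts equal to $j$ for each $j\ge1$, then $|\mathrm{Aut}\,\beta|=\prod_{j\ge1}f_j!$.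 For $\beta=(\beta_1,\ldots,\beta_k)$, $2\beta=(2\beta_1,\ldots,2\beta_k)$, and for indeterminates (or numbers) $a_1,a_2,\ldots$, $a_{\beta}=a_{\beta_1}\cdots a_{\beta_k}$ (empty product $=1$); so $\xi_{2\beta}=\prod_i\xi_{2\beta_i}$ and $q_{2\beta}(\alpha)=\prod_i q_{2\beta_i}(\alpha)$. For a partition $\alpha$, $p_i=p_i(\alpha)=\sum_j\alpha_j^i$ for $i\ge 1$, and $q_i(\alpha)=p_i(\alpha)+p_1(\alpha)-2$ for $i\ge2$. The numbers $\xi_{2j}$, $j\ge1$, are defined by the formal power series identity $$\sum_{j\ge1}\xi_{2j}x^{2j}=\log\xi(x),\qquad \xi(x)=2x^{-1}\sinh\left(\tfrac12 x\right).$$ "Polynomial in the parts of $\alpha$" is understood for each fixed $g$ and fixed number of parts $m$. *)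

theory Defs
  imports
    Complex_Main
    "HOL-Combinatorics.Orbits"
    "HOL-Library.Multiset"
    "HOL-Library.Poly_Mapping"
    "HOL-Computational_Algebra.Formal_Power_Series"
    "HOL-Algebra.Ring"
    "HOL-Algebra.Sym_Groups"
    "HOL-Algebra.Generated_Groups"
begin

section \<open>The group algebra and its centre\<close>

text \<open>
  The algebra of a \<^emph>\<open>finite\<close> group over the complex numbers: the function \<open>f\<close> stands for the
  formal sum of the \<open>f x \<cdot> x\<close>, and multiplication is convolution.
\<close>

definition group_algebra :: "('g, 'b) monoid_scheme \<Rightarrow> ('g \<Rightarrow> complex) ring" where
  "group_algebra G =
    \<lparr> carrier = {f. \<forall>x. x \<notin> carrier G \<longrightarrow> f x = 0},
      mult = (\<lambda>f h x. \<Sum>(y, z) \<in> {(y, z). y \<in> carrier G \<and> z \<in> carrier G \<and> y \<otimes>\<^bsub>G\<^esub> z = x}. f y * h z),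
      one = (\<lambda>x. if x = \<one>\<^bsub>G\<^esub> then 1 else 0),
      zero = (\<lambda>x. 0),
      add = (\<lambda>f h x. f x + h x) \<rparr>"

definition basis_elem :: "'g \<Rightarrow> 'g \<Rightarrow> complex" where
  "basis_elem x = (\<lambda>y. if y = x then 1 else 0)"

definition centre :: "('a, 'b) monoid_scheme \<Rightarrow> 'a set" where
  "centre R = {z \<in> carrier R. \<forall>a \<in> carrier R. z \<otimes>\<^bsub>R\<^esub> a = a \<otimes>\<^bsub>R\<^esub> z}"


section \<open>Transitive powers of Young-Jucys-Murphy elements\<close>

definition generates_transitive :: "nat \<Rightarrow> (nat \<Rightarrow> nat) list \<Rightarrow> bool" where
  "generates_transitive n \<sigma>s \<longleftrightarrow>
     (\<forall>x \<in> {1..n}. \<forall>y \<in> {1..n}. \<exists>\<tau> \<in> generate (sym_group n) (set \<sigma>s). \<tau> x = y)"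

text \<open>
  The operator \<open>T\<close> on one formal product, given as the list of its factors.  Multiplication in
  \<^const>\<open>sym_group\<close> is composition of functions.
\<close>

definition trans_op :: "nat \<Rightarrow> (nat \<Rightarrow> nat) list \<Rightarrow> (nat \<Rightarrow> nat) \<Rightarrow> complex" where
  "trans_op n \<sigma>s =
     (if generates_transitive n \<sigma>s
      then basis_elem (foldr (\<lambda>\<sigma> \<tau>. \<sigma> \<otimes>\<^bsub>sym_group n\<^esub> \<tau>) \<sigma>s \<one>\<^bsub>sym_group n\<^esub>)
      else (\<lambda>\<pi>. 0))"

text \<open>
  \<open>T\<close> applied linearly to the formal expansion of the \<open>r\<close>-th power of
  \<open>X\<^sub>n = (1 n) + \<dots> + (n-1 n)\<close>; the lists \<open>is\<close> are the tuples \<open>(i\<^sub>1, \<dots>, i\<^sub>r)\<close>.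
\<close>

definition trans_power :: "nat \<Rightarrow> nat \<Rightarrow> (nat \<Rightarrow> nat) \<Rightarrow> complex" where
  "trans_power n r =
     (\<lambda>\<pi>. \<Sum>is \<in> {is. set is \<subseteq> {1..n - 1} \<and> length is = r}. trans_op n (map (\<lambda>i. transpose i n) is) \<pi>)"


section \<open>Partitions and conjugacy classes\<close>

definition partitions_of :: "nat \<Rightarrow> nat list set" where
  "partitions_of n = {\<alpha>. sorted \<alpha> \<and> (\<forall>a \<in> set \<alpha>. 1 \<le> a) \<and> sum_list \<alpha> = n}"

definition cycle_type :: "nat \<Rightarrow> (nat \<Rightarrow> nat) \<Rightarrow> nat list" where
  "cycle_type n \<pi> = sorted_list_of_multiset (image_mset card (mset_set (orbit \<pi> ` {1..n})))"

definition conj_class :: "nat \<Rightarrow> nat list \<Rightarrow> (nat \<Rightarrow> nat) set" where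
  "conj_class n \<alpha> = {\<pi> \<in> carrier (sym_group n). cycle_type n \<pi> = \<alpha>}"

definition class_sum :: "nat \<Rightarrow> nat list \<Rightarrow> (nat \<Rightarrow> nat) \<Rightarrow> complex" where
  "class_sum n \<alpha> = (\<lambda>\<pi>. \<Sum>\<sigma> \<in> conj_class n \<alpha>. basis_elem \<sigma> \<pi>)"

definition card_Aut :: "nat list \<Rightarrow> nat" where
  "card_Aut \<beta> = (\<Prod>j \<in> set \<beta>. fact (count_list \<beta> j))"


section \<open>The coefficients\<close>

text \<open>\<open>\<xi>(x) = 2 x\<^sup>-\<^sup>1 sinh (x/2)\<close>, where \<open>2 sinh (x/2) = exp (x/2) - exp (-x/2)\<close>.\<close>

definition xi_series :: "complex fps" where
  "xi_series = (fps_exp (1/2) - fps_exp (- (1/2))) / fps_X"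

text \<open>
  \<^term>\<open>fps_ln 1\<close> is the series of \<open>log (1 + x)\<close>, and the series \<open>\<xi>(x)\<close> has constant term 1.
\<close>

definition log_xi :: "complex fps" where
  "log_xi = fps_ln 1 oo (xi_series - 1)"

definition xi :: "nat \<Rightarrow> complex" where
  "xi k = fps_nth log_xi k"

lemma xi_series_nth:
  "fps_nth xi_series k = ((1/2) ^ Suc k - (- (1/2)) ^ Suc k) / fact (Suc k)"
  unfolding xi_series_def by (simp add: fps_exp_def diff_divide_distrib add_divide_distrib mult_ac)

lemma xi_series_nth_0 [simp]: "fps_nth xi_series 0 = 1"
  by (simp add: xi_series_nth)

lemma xi_generating_function:
  "Abs_fps (\<lambda>k. if even k \<and> k \<ge> 2 then xi k else 0) = log_xi"
proof -
  have even: "xi_series oo (- fps_X) = xi_series"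
  proof (rule fps_ext)
    fix k
    show "fps_nth (xi_series oo (- fps_X)) k = fps_nth xi_series k"
      by (cases "even k") (simp_all add: fps_compose_uminus' xi_series_nth del: power_Suc)
  qed
  have "log_xi oo (- fps_X) = fps_ln 1 oo ((xi_series - 1) oo (- fps_X))"
    unfolding log_xi_def by (rule fps_compose_assoc [symmetric]) simp_all
  also have "(xi_series - 1) oo (- fps_X) = xi_series - 1"
    by (simp add: fps_compose_sub_distrib even)
  finally have log_even: "log_xi oo (- fps_X) = log_xi"
    by (simp add: log_xi_def)
  have odd: "fps_nth log_xi k = 0" if "odd k" for k
  proof -
    have "(-1) ^ k * fps_nth log_xi k = fps_nth log_xi k"
      using arg_cong [OF log_even, of "\<lambda>f. fps_nth f k"] by (simp add: fps_compose_uminus')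
    with that show ?thesis by simp
  qed
  have zero: "fps_nth log_xi 0 = 0"
    by (simp add: log_xi_def)
  show ?thesis
  proof (rule fps_ext)
    fix k :: nat
    have "k = 0" if "even k" "\<not> 2 \<le> k"
      using that by presburger
    then show "fps_nth (Abs_fps (\<lambda>k. if even k \<and> k \<ge> 2 then xi k else 0)) k = fps_nth log_xi k"
      using odd [of k] zero by (auto simp: xi_def)
  qed
qed

definition power_sum :: "nat \<Rightarrow> nat list \<Rightarrow> complex" where
  "power_sum i \<alpha> = (\<Sum>a\<leftarrow>\<alpha>. of_nat a ^ i)"

definition q :: "nat \<Rightarrow> nat list \<Rightarrow> complex" where
  "q i \<alpha> = power_sum i \<alpha> + power_sum 1 \<alpha> - 2"

definition Q :: "nat \<Rightarrow> nat list \<Rightarrow> complex" where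
  "Q g \<alpha> = (\<Sum>\<beta> \<in> partitions_of g.
     (\<Prod>b\<leftarrow>\<beta>. xi (2 * b)) * (\<Prod>b\<leftarrow>\<beta>. q (2 * b) \<alpha>) / of_nat (card_Aut \<beta>))"

text \<open>
  Here \<open>n = sum_list \<alpha>\<close> and \<open>m = length \<alpha>\<close>.  For nonempty \<open>\<alpha>\<close> with positive parts the
  subtraction of 2 does not truncate.
\<close>

definition coeff_a :: "nat \<Rightarrow> nat list \<Rightarrow> complex" where
  "coeff_a g \<alpha> =
     fact (sum_list \<alpha> + length \<alpha> + 2 * g - 2) / fact (sum_list \<alpha>) * (\<Prod>a\<leftarrow>\<alpha>. of_nat a) * Q g \<alpha>"


section \<open>Multivariate polynomials\<close>

text \<open>
  A polynomial maps monomials (finitely supported exponent functions on the variables) to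
  coefficients.
\<close>

type_synonym mpoly = "(nat \<Rightarrow>\<^sub>0 nat) \<Rightarrow>\<^sub>0 complex"

definition mpoly_vars :: "mpoly \<Rightarrow> nat set" where
  "mpoly_vars P = (\<Union>e \<in> Poly_Mapping.keys P. Poly_Mapping.keys e)"

definition mpoly_eval :: "(nat \<Rightarrow> complex) \<Rightarrow> mpoly \<Rightarrow> complex" where
  "mpoly_eval v P =
     (\<Sum>e \<in> Poly_Mapping.keys P.
        Poly_Mapping.lookup P e * (\<Prod>i \<in> Poly_Mapping.keys e. v i ^ Poly_Mapping.lookup e i))"

text \<open>
  One polynomial in \<open>m\<close> variables serves all partitions, of all \<open>n \<ge> 1\<close>, with exactly \<open>m\<close> parts;
  variable \<open>i\<close> stands for the part \<open>\<alpha> ! i\<close>.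
\<close>

definition polynomial_in_parts :: "nat \<Rightarrow> (nat list \<Rightarrow> complex) \<Rightarrow> bool" where
  "polynomial_in_parts m F \<longleftrightarrow>
     (\<exists>P. mpoly_vars P \<subseteq> {..<m} \<and>
        (\<forall>n \<ge> 1. \<forall>\<alpha> \<in> partitions_of n. length \<alpha> = m \<longrightarrow>
           F \<alpha> = mpoly_eval (\<lambda>i. of_nat (\<alpha> ! i)) P))"

end

theory Submission
  imports Defs "HOL-Computational_Algebra.Formal_Laurent_Series"
begin

text \<open>
  A product of star transpositions \<open>(i n)\<close> is transitive iff every \<open>i < n\<close> occurs, so the coefficient
  of \<open>\<pi>\<close> counts the words of length \<open>r\<close> that use all letters and multiply to \<open>\<pi>\<close>.  Let \<open>F\<^sub>\<pi>(x)\<close> be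
  the exponential generating function of these counts in \<open>r\<close>.  Removing the first letter \<open>i\<close> leaves a
  word for \<open>(i n) \<pi>\<close> which still uses all letters or uses all letters but \<open>i\<close>, and in the latter case
  \<open>\<pi> i = n\<close>; thus
  \<open>F\<^sub>\<pi>' = (\<Sum>i<n. F\<^bsub>(i n) \<pi>\<^esub>) + [\<pi> n \<noteq> n] F\<^bsub>(i n) \<pi>\<^esub>\<close>, where the last term lives on \<open>[n] - {i}\<close>
  for \<open>i = \<pi>\<^sup>-\<^sup>1 n\<close>.  Multiplication by \<open>(i n)\<close> merges two cycles or splits the cycle of \<open>n\<close>, and the addition
  formulas for \<open>sinh\<close> show that the recursion is solved by
  \<open>F\<^sub>\<pi>(x) = 1/n! (2 sinh (x/2))\<^bsup>n-2\<^esup> (\<Prod>C. 2 sinh (|C| x/2))\<close>, the product being over the cycles \<open>C\<close>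
  of \<open>\<pi>\<close>.  This depends only on the cycle type \<open>\<alpha>\<close>, hence centrality.  Writing
  \<open>2 sinh (a x/2) = a x \<xi>(a x)\<close> turns it into
  \<open>1/n! \<alpha>\<^sub>1 \<dots> \<alpha>\<^sub>m x\<^bsup>n+m-2\<^esup> \<xi>(x)\<^bsup>n-2\<^esup> (\<Prod>j. \<xi>(\<alpha>\<^sub>j x))\<close>, and the logarithm of the \<open>\<xi>\<close>-part is
  \<open>\<Sum>j. \<xi>\<^bsub>2j\<^esub> q\<^bsub>2j\<^esub>(\<alpha>) x\<^bsup>2j\<^esup>\<close>.
\<close>

section \<open>Orbits of a permutation multiplied by a transposition\<close>

text \<open>From any \<open>g j\<close> the iteration runs up to \<open>g (k - 1)\<close>, wraps
  round to \<open>g 0\<close> and from there reaches the whole list. The orbits after multiplication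
  by a transposition are found by exhibiting such a cyclic list.\<close>

lemma orbit_eq_image_lessThan:
  assumes "0 < k" and "\<And>j. Suc j < k \<Longrightarrow> \<sigma> (g j) = g (Suc j)" and "\<sigma> (g (k - 1)) = g 0"
    and "j < k"
  shows "orbit \<sigma> (g j) = g ` {..<k}"
proof -
  have step: "\<sigma> (g j) \<in> g ` {..<k}" if "j < k" for j
  proof (cases "Suc j < k")
    case True
    then show ?thesis using assms(2) by auto
  next
    case False
    then have "j = k - 1" using that by simp
    then show ?thesis using assms by auto
  qed
  have fwd: "g (j + d) \<in> orbit \<sigma> (g j)" if "0 < d" "j + d < k" for j d
    using that
  proof (induction d)
    case (Suc d)
    then have "\<sigma> (g (j + d)) = g (j + Suc d)" using assms(2) by simp
    with Suc show ?case
      by (cases "d = 0") (use orbit.base[of \<sigma> "g j"] orbit.step[of "g (j + d)" \<sigma> "g j"] in auto)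
  qed simp
  have last: "g (k - 1) \<in> orbit \<sigma> (g j)" if "j < k - 1" for j
    using fwd[of "k - 1 - j" j] that by simp
  have zero: "g 0 \<in> orbit \<sigma> (g j)" if "j < k" for j
  proof (cases "j = k - 1")
    case True
    then show ?thesis using orbit.base[of \<sigma> "g j"] assms(3) by simp
  next
    case False
    with that have "j < k - 1" by simp
    from orbit.step[OF last[OF this]] show ?thesis by (simp only: assms(3))
  qed
  have "g i \<in> orbit \<sigma> (g j)" if "i < k" "j < k" for i j
  proof (cases "i = 0")
    case True
    then show ?thesis using zero that by simp
  next
    case False
    then have "g i \<in> orbit \<sigma> (g 0)" using fwd[of i 0] that by simp
    then show ?thesis using zero[OF that(2)] by (rule orbit_trans)
  qed
  moreover have "y \<in> g ` {..<k}" if "y \<in> orbit \<sigma> (g j)" "j < k" for y j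
    using that by (induction rule: orbit.induct) (use step in auto)
  ultimately show ?thesis using assms(4) by blast
qed

text \<open>Identifies the cycle of \<open>x\<close> with the exponents
  \<open>0, ..., a - 1\<close>, so that the arcs into which it is cut become intervals of
  exponents.\<close>

lemma orbit_funpow_card:
  fixes \<pi> :: "'a \<Rightarrow> 'a" and x :: 'a
  assumes "permutation \<pi>"
  defines "a \<equiv> card (orbit \<pi> x)"
  shows "0 < a" "orbit \<pi> x = (\<lambda>j. (\<pi> ^^ j) x) ` {..<a}" "inj_on (\<lambda>j. (\<pi> ^^ j) x) {..<a}"
    "(\<pi> ^^ a) x = x"
proof -
  have self: "x \<in> orbit \<pi> x" using permutation_self_in_orbit[OF assms(1)] .
  let ?b = "funpow_dist1 \<pi> x x"
  have 1: "orbit \<pi> x = (\<lambda>n. (\<pi> ^^ n) x) ` {0..<?b}" by (rule orbit_conv_funpow_dist1[OF self])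
  have 2: "inj_on (\<lambda>n. (\<pi> ^^ n) x) {0..<?b}" by (rule inj_on_funpow_dist1[OF self])
  have 3: "a = ?b" unfolding a_def 1 using card_image[OF 2] by simp
  show "0 < a" using 3 by simp
  show "orbit \<pi> x = (\<lambda>j. (\<pi> ^^ j) x) ` {..<a}" "inj_on (\<lambda>j. (\<pi> ^^ j) x) {..<a}"
    using 1 2 by (simp_all add: 3 lessThan_atLeast0)
  show "(\<pi> ^^ a) x = x" unfolding 3 by (rule funpow_dist1_prop[OF self])
qed

lemma orbit_eq_of_mem:
  assumes "permutation \<pi>" "y \<in> orbit \<pi> x" shows "orbit \<pi> y = orbit \<pi> x"
  using assms orbit_cyclic_eq3 cyclic_on_orbit' by metis

text \<open>The transposition redirects only the two arrows of \<open>\<pi>\<close> that end in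
  \<open>i\<close> or \<open>x\<close>: the point with exponent \<open>k - 1\<close> now returns to
  \<open>x\<close>, and the last point of the cycle goes to \<open>i\<close>. So the cycle closes up
  separately on the exponents below \<open>k\<close> and on those from \<open>k\<close> on.\<close>

lemma transpose_comp_split:
  fixes \<pi> :: "'a \<Rightarrow> 'a" and x :: 'a
  assumes "permutation \<pi>" and "0 < k" and "k < card (orbit \<pi> x)"
  defines "i \<equiv> (\<pi> ^^ k) x"
  defines "\<sigma> \<equiv> transpose i x \<circ> \<pi>"
  shows "j < k \<Longrightarrow> orbit \<sigma> ((\<pi> ^^ j) x) = (\<lambda>j. (\<pi> ^^ j) x) ` {..<k}"
    and "k \<le> j \<Longrightarrow> j < card (orbit \<pi> x) \<Longrightarrow>
      orbit \<sigma> ((\<pi> ^^ j) x) = (\<lambda>j. (\<pi> ^^ j) x) ` {k..<card (orbit \<pi> x)}"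
proof -
  define a where "a = card (orbit \<pi> x)"
  let ?f = "\<lambda>j. (\<pi> ^^ j) x"
  note o = orbit_funpow_card[OF assms(1), of x, folded a_def]
  have k: "0 < k" "k < a" using assms by (simp_all add: a_def)
  have neq: "?f j = ?f l \<longleftrightarrow> j = l" if "j < a" "l < a" for j l
    using inj_onD[OF o(3)] that by auto
  have step: "\<sigma> (?f j) = ?f (Suc j)" if "Suc j < a" "Suc j \<noteq> k" for j
    using neq[of "Suc j" k] neq[of "Suc j" 0] that k
    by (simp add: \<sigma>_def i_def transpose_def)
  have stepk: "\<sigma> (?f (k - 1)) = x"
    using funpow_simps_right(2) k by (cases k) (auto simp: \<sigma>_def i_def)
  have stepa: "\<sigma> (?f (a - 1)) = i"
    using o(4) k by (cases a) (auto simp: \<sigma>_def)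
  {
    assume "j < k"
    have "orbit \<sigma> (?f j) = ?f ` {..<k}"
      by (rule orbit_eq_image_lessThan) (use step stepk k \<open>j < k\<close> in auto)
    then show "orbit \<sigma> (?f j) = ?f ` {..<k}" .
  next
    assume j: "k \<le> j" "j < card (orbit \<pi> x)"
    let ?g = "\<lambda>j. ?f (k + j)"
    have "orbit \<sigma> (?g (j - k)) = ?g ` {..<a - k}"
    proof (rule orbit_eq_image_lessThan)
      show "\<sigma> (?g (a - k - 1)) = ?g 0" using stepa k by (simp add: i_def)
      show "\<sigma> (?g j) = ?g (Suc j)" if "Suc j < a - k" for j
        using step[of "k + j"] that by simp
    qed (use k j a_def in auto)
    also have "?g ` {..<a - k} = ?f ` ((\<lambda>j. k + j) ` {..<a - k})" by (simp add: image_image)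
    also have "(\<lambda>j. k + j) ` {..<a - k} = {k..<a}"
      using k by (simp add: lessThan_atLeast0 add.commute)
    finally show "orbit \<sigma> (?f j) = ?f ` {k..<card (orbit \<pi> x)}" using j by (simp add: a_def)
  }
qed

text \<open>The last point of the cycle of \<open>x\<close> is redirected to \<open>i\<close> and
  the last point of the cycle of \<open>i\<close> to \<open>x\<close>. Hence the first cycle
  followed by the second, called \<open>?g\<close> in the proof, is one cyclic list.\<close>

lemma transpose_comp_merge:
  fixes \<pi> :: "'a \<Rightarrow> 'a" and x :: 'a
  assumes "permutation \<pi>" and "i \<notin> orbit \<pi> x" and "y \<in> orbit \<pi> x \<union> orbit \<pi> i"
  shows "orbit (transpose i x \<circ> \<pi>) y = orbit \<pi> x \<union> orbit \<pi> i"
proof -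
  define a where "a = card (orbit \<pi> x)"
  define b where "b = card (orbit \<pi> i)"
  define \<sigma> where "\<sigma> = transpose i x \<circ> \<pi>"
  let ?g = "\<lambda>j. if j < a then (\<pi> ^^ j) x else (\<pi> ^^ (j - a)) i"
  note o = orbit_funpow_card[OF assms(1), of x, folded a_def]
  note p = orbit_funpow_card[OF assms(1), of i, folded b_def]
  have x_notin: "x \<notin> orbit \<pi> i"
    using assms(1,2) orbit_eq_of_mem permutation_self_in_orbit by metis
  have neqx: "(\<pi> ^^ j) x = x \<longleftrightarrow> j = 0" if "j < a" for j
    using inj_onD[OF o(3), of j 0] that by auto
  have neqi: "(\<pi> ^^ j) i = i \<longleftrightarrow> j = 0" if "j < b" for j
    using inj_onD[OF p(3), of j 0] that by auto
  have in_x: "(\<pi> ^^ j) x \<in> orbit \<pi> x" and in_i: "(\<pi> ^^ j) i \<in> orbit \<pi> i" for j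
    using assms(1) by (auto simp: orbit_altdef_permutation)
  have ne: "(\<pi> ^^ j) x \<noteq> i" "(\<pi> ^^ j) i \<noteq> x" for j
    using in_x in_i assms(2) x_notin by metis+
  have image: "?g ` {..<a + b} = orbit \<pi> x \<union> orbit \<pi> i"
  proof -
    have "{..<a + b} = {..<a} \<union> (\<lambda>j. a + j) ` {..<b}"
      by (simp add: lessThan_atLeast0 ivl_disj_un image_add_atLeastLessThan' add.commute)
    then have "?g ` {..<a + b} = ?g ` {..<a} \<union> ?g ` (\<lambda>j. a + j) ` {..<b}" by (simp only: image_Un)
    also have "?g ` {..<a} = orbit \<pi> x" unfolding o(2) by (intro image_cong) auto
    also have "?g ` (\<lambda>j. a + j) ` {..<b} = orbit \<pi> i" 
      unfolding p(2) image_image by (intro image_cong) auto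
    finally show ?thesis .
  qed
  have step: "\<sigma> (?g j) = ?g (Suc j)" if j: "Suc j < a + b" for j
  proof -
    consider "Suc j < a" | "Suc j = a" | "a \<le> j" by linarith
    then show ?thesis
    proof cases
      case 1
      then show ?thesis using neqx[of "Suc j"] ne(1)[of "Suc j"] by (simp add: \<sigma>_def transpose_def)
    next
      case 2
      then have "\<pi> ((\<pi> ^^ j) x) = x" using o(4) by auto
      then show ?thesis using 2 by (auto simp: \<sigma>_def)
    next
      case 3
      then show ?thesis using neqi[of "Suc (j - a)"] ne(2)[of "Suc (j - a)"] j
        by (simp add: \<sigma>_def transpose_def Suc_diff_le)
    qed
  qed
  have last: "\<sigma> (?g (a + b - 1)) = ?g 0"
  proof -
    have "\<pi> ((\<pi> ^^ (b - 1)) i) = i" using p(1,4) by (cases b) auto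
    then show ?thesis using o(1) p(1) by (auto simp: \<sigma>_def)
  qed
  obtain j where "j < a + b" "y = ?g j" using assms(3) unfolding image[symmetric] by blast
  then show ?thesis
    using orbit_eq_image_lessThan[of "a + b" \<sigma> ?g j] step last o(1) unfolding image \<sigma>_def by auto
qed

lemma transpose_comp_orbit_cong:
  assumes "permutation \<pi>" and "y \<notin> orbit \<pi> x" and "y \<notin> orbit \<pi> i"
  shows "orbit (transpose i x \<circ> \<pi>) y = orbit \<pi> y"
proof -
  have "z \<noteq> x" "z \<noteq> i" if "z \<in> orbit \<pi> y" for z
    using that assms orbit_eq_of_mem permutation_self_in_orbit by metis+
  moreover have "\<pi> z \<in> orbit \<pi> y" if "z \<in> orbit \<pi> y" for z using that by (rule orbit.step)
  ultimately show ?thesis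
    by (intro orbit_cong0[of y "orbit \<pi> y", symmetric])
      (use assms permutation_self_in_orbit in \<open>auto simp: transpose_def\<close>)
qed

lemma sum_card_orbits:
  assumes "finite S" "\<pi> permutes S"
  shows "sum card (orbit \<pi> ` S) = card S"
proof -
  have perm: "permutation \<pi>" using assms permutation_permutes by blast
  have "card (\<Union> (orbit \<pi> ` S)) = sum card (orbit \<pi> ` S)"
  proof (rule card_Union_disjoint)
    show "pairwise disjnt (orbit \<pi> ` S)"
      using orbit_eq_of_mem[OF perm] unfolding pairwise_def disjnt_def by blast
    show "finite A" if "A \<in> orbit \<pi> ` S" for A
      using that permutes_orbit_subset[OF assms(2)] assms(1) finite_subset by blast
  qed
  moreover have "\<Union> (orbit \<pi> ` S) = S"
    using permutation_self_in_orbit[OF perm] permutes_orbit_subset[OF assms(2)] by blast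
  ultimately show ?thesis by simp
qed

section \<open>Products over the cycles of a permutation\<close>

text \<open>The weight \<open>h\<close> is arbitrary, which keeps the cutting and joining of cycles
  apart from power series. The ground set is explicit because the recursion also needs
  \<open>S - {i}\<close>.\<close>

definition orbit_prod :: "(nat \<Rightarrow> 'b::comm_monoid_mult) \<Rightarrow> 'a set \<Rightarrow> ('a \<Rightarrow> 'a) \<Rightarrow> 'b" where
  "orbit_prod h S \<pi> = (\<Prod>C \<in> orbit \<pi> ` S. h (card C))"

lemma orbit_image_Diff:
  assumes "permutation \<pi>"
  shows "orbit \<pi> ` (S - orbit \<pi> x) = orbit \<pi> ` S - {orbit \<pi> x}"
  using orbit_eq_of_mem[OF assms] permutation_self_in_orbit[OF assms] by fastforce

lemma orbit_prod_remove:
  assumes "finite S" "x \<in> S"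
  shows "orbit_prod h S \<pi> = h (card (orbit \<pi> x)) * (\<Prod>C \<in> orbit \<pi> ` S - {orbit \<pi> x}. h (card C))"
  unfolding orbit_prod_def by (rule prod.remove) (use assms in auto)

context
  fixes S :: "'a set" and \<pi> :: "'a \<Rightarrow> 'a"
  assumes S: "finite S" and \<pi>: "\<pi> permutes S"
begin

private lemma perm: "permutation \<pi>"
  using S \<pi> permutation_permutes by blast

text \<open>\<open>R\<close> collects the untouched cycles. In the second equation the upper arc is
  the single point \<open>(\<pi> ^^ k) x\<close>, which leaves the ground set together with its
  factor \<open>h 1\<close>.\<close>

lemma orbit_prod_split:
  fixes h :: "nat \<Rightarrow> 'b::comm_monoid_mult"
  assumes "x \<in> S" and "0 < k" and "k < card (orbit \<pi> x)"
  defines "\<sigma> \<equiv> transpose ((\<pi> ^^ k) x) x \<circ> \<pi>"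
    and "R \<equiv> \<Prod>C \<in> orbit \<pi> ` S - {orbit \<pi> x}. h (card C)"
  shows "orbit_prod h S \<sigma> = h k * h (card (orbit \<pi> x) - k) * R"
    and "Suc k = card (orbit \<pi> x) \<Longrightarrow> orbit_prod h (S - {(\<pi> ^^ k) x}) \<sigma> = h k * R"
proof -
  let ?f = "\<lambda>j. (\<pi> ^^ j) x"
  define D where "D = orbit \<pi> x"
  define a where "a = card D"
  have k: "0 < k" "k < a" using assms by (simp_all add: a_def D_def)
  note o = orbit_funpow_card[OF perm, of x, folded D_def, folded a_def]
  have D_sub: "D \<subseteq> S" unfolding D_def by (rule permutes_orbit_subset[OF \<pi> assms(1)])
  have lo: "orbit \<sigma> (?f j) = ?f ` {..<k}" if "j < k" for j
    using transpose_comp_split(1)[OF perm assms(2,3) that] by (simp add: \<sigma>_def)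
  have hi: "orbit \<sigma> (?f j) = ?f ` {k..<a}" if "k \<le> j" "j < a" for j
    using transpose_comp_split(2)[OF perm assms(2,3)] that by (simp add: \<sigma>_def a_def D_def)
  have "orbit \<sigma> y = orbit \<pi> y" if "y \<in> S - D" for y
  proof -
    have "orbit \<pi> ((\<pi> ^^ k) x) = D"
      unfolding D_def by (intro orbit_eq_of_mem[OF perm]) (use o k in \<open>auto simp: D_def\<close>)
    then show ?thesis
      unfolding \<sigma>_def using that by (intro transpose_comp_orbit_cong[OF perm]) (auto simp: D_def)
  qed
  then have rest: "orbit \<sigma> ` (S - D) = orbit \<pi> ` S - {orbit \<pi> x}"
    using orbit_image_Diff[OF perm, of S x] by (auto simp: D_def)
  have R_disj: "C \<inter> D = {}" if "C \<in> orbit \<pi> ` S - {orbit \<pi> x}" for C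
    using that orbit_eq_of_mem[OF perm] unfolding D_def by blast
  define A where "A = ?f ` {..<k}"
  define B where "B = ?f ` {k..<a}"
  have cards: "card A = k" "card B = a - k"
    using k inj_on_subset[OF o(3), of "{..<k}"] inj_on_subset[OF o(3), of "{k..<a}"]
    by (auto simp: A_def B_def card_image subset_iff)
  have AB: "D = A \<union> B"
    unfolding o(2) A_def B_def image_Un[symmetric] using k by (simp add: ivl_disj_un)
  have "A \<inter> B = ?f ` ({..<k} \<inter> {k..<a})"
    unfolding A_def B_def by (rule inj_on_image_Int[OF o(3), symmetric]) (use k in auto)
  then have disj: "A \<inter> B = {}" by (simp add: lessThan_atLeast0)
  have ne: "A \<noteq> {}" "B \<noteq> {}" using k by (auto simp: A_def B_def)
  \<comment> \<open>The product runs over a set of cycles, so the factors of \<open>A\<close> and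
    \<open>B\<close> can be split off only if these differ from each other and from the remaining
    cycles.\<close>
  have notin: "A \<notin> orbit \<pi> ` S - {orbit \<pi> x}" "B \<notin> orbit \<pi> ` S - {orbit \<pi> x}" "A \<noteq> B"
    using R_disj[of A] R_disj[of B] AB disj ne by blast+
  have A: "orbit \<sigma> ` A = {A}"
  proof -
    have "orbit \<sigma> y = A" if "y \<in> A" for y using that lo unfolding A_def by blast
    then show ?thesis using ne by auto
  qed
  have B: "orbit \<sigma> ` B = {B}"
  proof -
    have "orbit \<sigma> y = B" if "y \<in> B" for y using that hi unfolding B_def by fastforce
    then show ?thesis using ne by auto
  qed
  have "S = A \<union> (B \<union> (S - D))" using D_sub AB by blast
  then have "orbit \<sigma> ` S = insert A (insert B (orbit \<pi> ` S - {orbit \<pi> x}))"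
    using rest A B by (metis image_Un insert_is_Un)
  then show "orbit_prod h S \<sigma> = h k * h (card (orbit \<pi> x) - k) * R"
    using S notin cards by (simp add: orbit_prod_def R_def a_def D_def mult.assoc)
  assume "Suc k = card (orbit \<pi> x)"
  then have "{k..<a} = {k}" by (auto simp: a_def D_def)
  then have "B = {(\<pi> ^^ k) x}" by (simp add: B_def)
  then have "S - {(\<pi> ^^ k) x} = A \<union> (S - D)"
    using D_sub AB disj by auto
  then have "orbit \<sigma> ` (S - {(\<pi> ^^ k) x}) = insert A (orbit \<pi> ` S - {orbit \<pi> x})"
    using rest A by (simp add: image_Un)
  then show "orbit_prod h (S - {(\<pi> ^^ k) x}) \<sigma> = h k * R"
    using S notin cards by (simp add: orbit_prod_def R_def)
qed

lemma orbit_prod_merge: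
  fixes h :: "nat \<Rightarrow> 'b::comm_monoid_mult"
  assumes "x \<in> S" and "i \<in> S" and "i \<notin> orbit \<pi> x"
  shows "orbit_prod h S (transpose i x \<circ> \<pi>) =
    h (card (orbit \<pi> x) + card (orbit \<pi> i)) *
    (\<Prod>C \<in> orbit \<pi> ` S - {orbit \<pi> x} - {orbit \<pi> i}. h (card C))"
proof -
  define \<sigma> where "\<sigma> = transpose i x \<circ> \<pi>"
  let ?D = "orbit \<pi> x \<union> orbit \<pi> i" and ?R = "orbit \<pi> ` S - {orbit \<pi> x} - {orbit \<pi> i}"
  have disj: "orbit \<pi> x \<inter> orbit \<pi> i = {}"
    using assms(3) orbit_eq_of_mem[OF perm] permutation_self_in_orbit[OF perm] by blast
  have fin: "finite (orbit \<pi> y)" for y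
    using finite_orbit permutation_self_in_orbit[OF perm] by metis
  have D_sub: "?D \<subseteq> S"
    using permutes_orbit_subset[OF \<pi> assms(1)] permutes_orbit_subset[OF \<pi> assms(2)] by blast
  have "orbit \<sigma> ` ?D = {?D}"
    using transpose_comp_merge[OF perm assms(3)] permutation_self_in_orbit[OF perm, of x]
    unfolding \<sigma>_def by blast
  moreover have "orbit \<sigma> ` (S - ?D) = ?R"
  proof -
    have "orbit \<sigma> ` (S - ?D) = orbit \<pi> ` (S - ?D)"
      unfolding \<sigma>_def by (intro image_cong refl transpose_comp_orbit_cong[OF perm]) auto
    also have "\<dots> = ?R"
      using orbit_eq_of_mem[OF perm] permutation_self_in_orbit[OF perm] by fastforce
    finally show ?thesis .
  qed
  moreover have "S = ?D \<union> (S - ?D)" using D_sub by blast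
  ultimately have "orbit \<sigma> ` S = insert ?D ?R" by (metis image_Un insert_is_Un)
  moreover have "?D \<notin> ?R"
  proof
    assume "?D \<in> ?R"
    then obtain y where "?D = orbit \<pi> y" "orbit \<pi> y \<noteq> orbit \<pi> x" by blast
    then show False using orbit_eq_of_mem[OF perm] permutation_self_in_orbit[OF perm, of x] by blast
  qed
  ultimately show ?thesis
    using S disj fin by (simp add: orbit_prod_def card_Un_disjoint flip: \<sigma>_def)
qed

text \<open>The points \<open>(\<pi> ^^ k) x\<close> with \<open>1 \<le> k < a\<close> cut the cycle
  of \<open>x\<close> into lengths \<open>k\<close> and \<open>a - k\<close>. The points outside are
  grouped by their cycle \<open>C\<close>; each of the \<open>card C\<close> points of
  \<open>C\<close> joins it to the cycle of \<open>x\<close> with the same result.\<close>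

lemma sum_orbit_prod_transpose:
  fixes h :: "nat \<Rightarrow> 'b::comm_semiring_1"
  assumes "x \<in> S"
  defines "a \<equiv> card (orbit \<pi> x)" and "O' \<equiv> orbit \<pi> ` S - {orbit \<pi> x}"
  shows "(\<Sum>i \<in> S - {x}. orbit_prod h S (transpose i x \<circ> \<pi>)) =
    (\<Sum>k = 1..<a. h k * h (a - k)) * (\<Prod>C \<in> O'. h (card C)) +
    (\<Sum>C \<in> O'. of_nat (card C) * h (a + card C) * (\<Prod>C' \<in> O' - {C}. h (card C')))"
proof -
  let ?f = "\<lambda>j. (\<pi> ^^ j) x" and ?D = "orbit \<pi> x"
  let ?t = "\<lambda>i. orbit_prod h S (transpose i x \<circ> \<pi>)"
  note o = orbit_funpow_card[OF perm, of x, folded a_def]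
  have D_sub: "?D \<subseteq> S" by (rule permutes_orbit_subset[OF \<pi> assms(1)])
  have fin: "finite ?D" using D_sub S finite_subset by blast
  have x_in: "x \<in> ?D" by (rule permutation_self_in_orbit[OF perm])
  have inj: "inj_on ?f {1..<a}" by (rule inj_on_subset[OF o(3)]) auto
  have D_x: "?D - {x} = ?f ` {1..<a}"
  proof -
    have "{..<a} = insert 0 {1..<a}" using o(1) by auto
    then have "?D = insert x (?f ` {1..<a})" using o(2) by simp
    moreover have "x \<notin> ?f ` {1..<a}" using inj_onD[OF o(3), of 0] o(1) by fastforce
    ultimately show ?thesis by blast
  qed
  have "S - {x} = (?D - {x}) \<union> (S - ?D)" using D_sub x_in by blast
  then have "sum ?t (S - {x}) = sum ?t (?D - {x}) + sum ?t (S - ?D)"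
    using sum.union_disjoint[of "?D - {x}" "S - ?D" ?t] fin S by auto
  also have "sum ?t (?D - {x}) = (\<Sum>k = 1..<a. ?t (?f k))"
    unfolding D_x using sum.reindex[OF inj, of ?t] by simp
  also have "\<dots> = (\<Sum>k = 1..<a. h k * h (a - k) * (\<Prod>C \<in> O'. h (card C)))"
    by (intro sum.cong refl, subst orbit_prod_split(1)[OF assms(1)]) (auto simp: a_def O'_def)
  also have "\<dots> = (\<Sum>k = 1..<a. h k * h (a - k)) * (\<Prod>C \<in> O'. h (card C))"
    by (simp add: sum_distrib_right)
  also have "sum ?t (S - ?D) =
      (\<Sum>i \<in> S - ?D. h (a + card (orbit \<pi> i)) * (\<Prod>C' \<in> O' - {orbit \<pi> i}. h (card C')))"
    by (intro sum.cong refl) (auto simp: a_def O'_def orbit_prod_merge[OF assms(1)])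
  also have "\<dots> = (\<Sum>C \<in> orbit \<pi> ` (S - ?D). \<Sum>i \<in> {i \<in> S - ?D. orbit \<pi> i = C}.
      h (a + card (orbit \<pi> i)) * (\<Prod>C' \<in> O' - {orbit \<pi> i}. h (card C')))"
    by (rule sum.image_gen) (use S in simp)
  also have "\<dots> = (\<Sum>C \<in> O'. of_nat (card C) * h (a + card C) * (\<Prod>C' \<in> O' - {C}. h (card C')))"
  proof (rule sum.cong)
    show "orbit \<pi> ` (S - ?D) = O'" unfolding O'_def by (rule orbit_image_Diff[OF perm])
    fix C assume C: "C \<in> O'"
    have "{i \<in> S - ?D. orbit \<pi> i = C} = C"
    proof (intro equalityI subsetI)
      obtain y where y: "y \<in> S" "C = orbit \<pi> y" "C \<noteq> ?D" using C by (auto simp: O'_def)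
      fix i assume "i \<in> C"
      then have "orbit \<pi> i = C" "i \<in> S"
        using y orbit_eq_of_mem[OF perm] permutes_orbit_subset[OF \<pi>] by auto
      then show "i \<in> {i \<in> S - ?D. orbit \<pi> i = C}" using y(3) orbit_eq_of_mem[OF perm, of i x] by auto
    qed (use permutation_self_in_orbit[OF perm] in auto)
    then have "(\<Sum>i \<in> {i \<in> S - ?D. orbit \<pi> i = C}.
        h (a + card (orbit \<pi> i)) * (\<Prod>C' \<in> O' - {orbit \<pi> i}. h (card C'))) =
        (\<Sum>i \<in> C. h (a + card C) * (\<Prod>C' \<in> O' - {C}. h (card C')))"
      by (intro sum.cong) auto
    then show "(\<Sum>i \<in> {i \<in> S - ?D. orbit \<pi> i = C}.
        h (a + card (orbit \<pi> i)) * (\<Prod>C' \<in> O' - {orbit \<pi> i}. h (card C'))) =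
        of_nat (card C) * h (a + card C) * (\<Prod>C' \<in> O' - {C}. h (card C'))"
      by (simp add: mult.assoc)
  qed
  finally show ?thesis .
qed

text \<open>Only the predecessor of \<open>x\<close> on its cycle can be an index of the sum. If
  \<open>x\<close> is a fixed point, the sum is empty, and \<open>h 0 = 0\<close> makes the right
  side vanish as well.\<close>

lemma sum_orbit_prod_transpose_fixed:
  fixes h :: "nat \<Rightarrow> 'b::comm_semiring_1"
  assumes "x \<in> S" and "h 0 = 0"
  shows "(\<Sum>i \<in> {i \<in> S - {x}. \<pi> i = x}. orbit_prod h (S - {i}) (transpose i x \<circ> \<pi>)) =
    h (card (orbit \<pi> x) - 1) * (\<Prod>C \<in> orbit \<pi> ` S - {orbit \<pi> x}. h (card C))"
proof -
  define a where "a = card (orbit \<pi> x)"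
  note o = orbit_funpow_card[OF perm, of x, folded a_def]
  define i where "i = (\<pi> ^^ (a - 1)) x"
  have i: "\<pi> i = x" using o(1,4) by (cases a) (auto simp: i_def)
  have "inj \<pi>" using \<pi> by (rule permutes_inj)
  then have uniq: "j = i" if "\<pi> j = x" for j using that i by (metis injD)
  have "i \<in> orbit \<pi> x" using o(1,2) by (auto simp: i_def)
  then have "i \<in> S" using permutes_orbit_subset[OF \<pi> assms(1)] by blast
  show ?thesis
  proof (cases "a = 1")
    case True
    then have "{i \<in> S - {x}. \<pi> i = x} = {}" using uniq by (auto simp: i_def)
    then show ?thesis using True assms(2) by (simp only: a_def) simp
  next
    case False
    then have a: "0 < a - 1" "a - 1 < a" "Suc (a - 1) = a" using o(1) by auto
    have "i \<noteq> x" using inj_onD[OF o(3), of 0 "a - 1"] a by (auto simp: i_def)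
    then have "{i \<in> S - {x}. \<pi> i = x} = {i}" using uniq i \<open>i \<in> S\<close> by blast
    then show ?thesis
      using orbit_prod_split(2)[OF assms(1), of "a - 1"] a by (simp add: a_def i_def)
  qed
qed

end

section \<open>The hyperbolic sine ansatz\<close>

text \<open>The series \<open>2 sinh (z x / 2)\<close>. A complex \<open>z\<close> admits the
  negative and shifted arguments that occur in the addition formulas.\<close>

definition two_sinh :: "complex \<Rightarrow> complex fps" where
  "two_sinh z = fps_exp (z / 2) - fps_exp (- (z / 2))"

definition two_cosh :: "complex \<Rightarrow> complex fps" where
  "two_cosh z = fps_exp (z / 2) + fps_exp (- (z / 2))"

lemma two_sinh_0 [simp]: "two_sinh 0 = 0"
  by (simp add: two_sinh_def)

lemma two_sinh_nth_0 [simp]: "fps_nth (two_sinh z) 0 = 0"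
  by (simp add: two_sinh_def)

lemma two_sinh_1_nz [simp]: "two_sinh 1 \<noteq> 0"
  by (simp add: two_sinh_def)

lemma two_sinh_minus: "two_sinh (- z) = - two_sinh z"
  by (simp add: two_sinh_def)

lemma fps_deriv_two_sinh: "fps_deriv (two_sinh z) = fps_const (z / 2) * two_cosh z"
  by (simp add: two_sinh_def two_cosh_def algebra_simps flip: fps_const_neg)

lemma two_sinh_add: "2 * two_sinh (z + w) = two_sinh z * two_cosh w + two_cosh z * two_sinh w"
  by (simp add: two_sinh_def two_cosh_def algebra_simps add_divide_distrib flip: fps_exp_add_mult)

lemma two_sinh_diff: "2 * two_sinh (z - w) = two_sinh z * two_cosh w - two_cosh z * two_sinh w"
  using two_sinh_add[of z "- w"] by (simp add: two_sinh_minus) (simp add: two_cosh_def add.commute)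

lemma two_sinh_mult: "two_sinh z * two_sinh w = two_cosh (z + w) - two_cosh (z - w)"
  by (simp add: two_sinh_def two_cosh_def algebra_simps add_divide_distrib diff_divide_distrib
      flip: fps_exp_add_mult)

lemma two_sinh_mult_cosh: "two_sinh 1 * two_cosh z = two_sinh (z + 1) - two_sinh (z - 1)"
  by (simp add: two_sinh_def two_cosh_def algebra_simps add_divide_distrib diff_divide_distrib
      flip: fps_exp_add_mult)

text \<open>Each summand is \<open>two_cosh a - two_cosh (a - 2 k)\<close>, and after multiplication
  by \<open>two_sinh 1\<close> the sum of the second terms telescopes. This is the contribution of
  the cuts.\<close>

lemma sum_two_sinh_mult:
  assumes "1 \<le> a"
  shows "two_sinh 1 * (\<Sum>k = 1..<a. two_sinh (of_nat k) * two_sinh (of_nat (a - k))) =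
    of_nat (a - 1) * two_sinh 1 * two_cosh (of_nat a) - 2 * two_sinh (of_nat a - 1)"
proof -
  have telescope: "two_sinh 1 * (\<Sum>k = 1..<Suc m. two_cosh (z - 2 * of_nat k)) =
      two_sinh (z - 1) - two_sinh (z - 2 * of_nat m - 1)" for m z
    by (induction m) (simp_all add: distrib_left two_sinh_mult_cosh algebra_simps)
  have "two_sinh (of_nat k) * two_sinh (of_nat (a - k)) =
      two_cosh (of_nat a) - two_cosh (of_nat a - 2 * of_nat k)" if "k \<in> {1..<a}" for k
    using that two_sinh_mult[of "of_nat (a - k)" "of_nat k"] by (simp add: mult.commute)
  then have "two_sinh 1 * (\<Sum>k = 1..<a. two_sinh (of_nat k) * two_sinh (of_nat (a - k))) =
      two_sinh 1 * (\<Sum>k = 1..<a. two_cosh (of_nat a) - two_cosh (of_nat a - 2 * of_nat k))"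
    by simp
  also have "\<dots> = of_nat (a - 1) * two_sinh 1 * two_cosh (of_nat a) -
      two_sinh 1 * (\<Sum>k = 1..<Suc (a - 1). two_cosh (of_nat a - 2 * of_nat k))"
    using assms by (simp add: sum_subtractf algebra_simps)
  \<comment> \<open>The two ends of the telescope have opposite arguments, so by oddness of
    \<open>two_sinh\<close> they add up.\<close>
  also have "of_nat a - 2 * of_nat (a - 1) - 1 = - (of_nat a - 1 :: complex)"
    using assms by (simp add: of_nat_diff)
  then have "two_sinh 1 * (\<Sum>k = 1..<Suc (a - 1). two_cosh (of_nat a - 2 * of_nat k)) =
      2 * two_sinh (of_nat a - 1)"
    using two_sinh_minus[of "of_nat a - 1"] by (simp only: telescope) simp
  finally show ?thesis .
qed

section \<open>The differential equation for the products of hyperbolic sines\<close>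

lemma fps_deriv_prod:
  fixes f :: "'b \<Rightarrow> 'a::comm_ring_1 fps"
  assumes "finite A"
  shows "fps_deriv (\<Prod>x \<in> A. f x) = (\<Sum>x \<in> A. fps_deriv (f x) * (\<Prod>y \<in> A - {x}. f y))"
  using assms
proof (induction A rule: finite_induct)
  case (insert x A)
  have "(\<Prod>y \<in> insert x A - {z}. f y) = f x * (\<Prod>y \<in> A - {z}. f y)" if "z \<in> A" for z
    using that insert.hyps by (subst insert_Diff_if) auto
  then have "(\<Sum>z \<in> A. fps_deriv (f z) * (\<Prod>y \<in> insert x A - {z}. f y)) =
      f x * (\<Sum>z \<in> A. fps_deriv (f z) * (\<Prod>y \<in> A - {z}. f y))"
    by (simp add: sum_distrib_left mult.left_commute)
  then show ?case using insert by (simp add: mult.commute)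
qed simp

abbreviation sinh_prod :: "'a set \<Rightarrow> ('a \<Rightarrow> 'a) \<Rightarrow> complex fps" where
  "sinh_prod \<equiv> orbit_prod (\<lambda>k. two_sinh (of_nat k))"

text \<open>The algebra behind \<open>sinh_prod_ode\<close>. There \<open>u\<close> is
  \<open>two_sinh 1\<close>, \<open>sa\<close> and \<open>ca\<close> are sinh and cosh for the cycle
  of \<open>x\<close>, \<open>R\<close> is the product over the other cycles and \<open>B\<close>
  their total length, \<open>K\<close> and \<open>J\<close> are the sums over cuts and joins, and
  \<open>p\<close> is \<open>two_sinh (a - 1)\<close>. Everything is doubled to avoid
  fractions.\<close>

lemma sinh_ode_ring_identity:
  fixes du :: "'a::idom"
  assumes "2 * du = c1" "2 * dsa = a * ca" "2 * dR = T" "2 * J = sa * T + B * ca * R"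
    "u * K = (a - 1) * u * ca - 2 * p" "2 * p = sa * c1 - ca * u"
  shows "2 * ((a + B) * du * (sa * R) + u * (sa * dR + dsa * R) - 2 * du * (sa * R)) =
    2 * (u * (K * R + J) + (a + B) * (p * R))"
proof -
  have "2 * ((a + B) * du * (sa * R) + u * (sa * dR + dsa * R) - 2 * du * (sa * R)) =
    (a + B - 2) * (2 * du) * (sa * R) + u * (sa * (2 * dR) + (2 * dsa) * R)"
    by (simp add: algebra_simps)
  also have "\<dots> = 2 * R * ((a - 1) * u * ca) + u * (sa * T + B * ca * R)
      + (a + B - 2) * R * (sa * c1 - ca * u)"
    unfolding assms(1-3) by (simp add: algebra_simps)
  also have "\<dots> = 2 * R * (u * K) + u * (2 * J) + (a + B) * R * (2 * p)"
    unfolding assms(4-5) assms(6)[symmetric] by (simp add: algebra_simps)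
  also have "\<dots> = 2 * (u * (K * R + J) + (a + B) * (p * R))"
    by (simp add: algebra_simps)
  finally show ?thesis .
qed

text \<open>With \<open>n = card S\<close> and \<open>u = two_sinh 1\<close>, this is the recursion
  for \<open>F = u^(n-2) P / n!\<close> multiplied by \<open>n! u^(3-n)\<close>. The term with
  factor \<open>2\<close> stays separate because \<open>card S - 2\<close> would truncate for a
  one-point set.\<close>

lemma sinh_prod_ode:
  assumes S: "finite S" and \<pi>: "\<pi> permutes S" and x: "x \<in> S"
  shows "of_nat (card S) * fps_deriv (two_sinh 1) * sinh_prod S \<pi> + two_sinh 1 * fps_deriv (sinh_prod S \<pi>)
      - 2 * fps_deriv (two_sinh 1) * sinh_prod S \<pi> =
    two_sinh 1 * (\<Sum>i \<in> S - {x}. sinh_prod S (transpose i x \<circ> \<pi>)) +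
    of_nat (card S) *
      (\<Sum>i \<in> {i \<in> S - {x}. \<pi> i = x}. sinh_prod (S - {i}) (transpose i x \<circ> \<pi>))"
proof -
  have perm: "permutation \<pi>" using S \<pi> permutation_permutes by blast
  define a where "a = card (orbit \<pi> x)"
  define P where "P = orbit \<pi> ` S - {orbit \<pi> x}"
  define s where "s = (\<lambda>C :: 'a set. two_sinh (of_nat (card C)))"
  define c where "c = (\<lambda>C :: 'a set. two_cosh (of_nat (card C)))"
  define R where "R = prod s P"
  define T where "T = (\<Sum>C \<in> P. of_nat (card C) * c C * prod s (P - {C}))"
  define u where "u = two_sinh 1"
  define sa where "sa = two_sinh (of_nat a)"
  define ca where "ca = two_cosh (of_nat a)"
  have fin: "finite P" using S by (simp add: P_def)
  have a: "1 \<le> a" using orbit_funpow_card(1)[OF perm, of x] by (simp add: a_def)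
  have card_S: "card S = a + (\<Sum>C \<in> P. card C)"
  proof -
    have "card S = sum card (orbit \<pi> ` S)" by (rule sum_card_orbits[OF S \<pi>, symmetric])
    also have "\<dots> = a + sum card P"
      unfolding P_def a_def by (rule sum.remove) (use S x in auto)
    finally show ?thesis .
  qed
  have P_eq: "sinh_prod S \<pi> = sa * R"
    using orbit_prod_remove[OF S x] by (simp add: sa_def R_def s_def P_def a_def)
  have du: "2 * fps_deriv u = two_cosh 1"
    by (simp add: u_def fps_deriv_two_sinh numeral_fps_const flip: mult.assoc)
  have dsa: "2 * fps_deriv sa = of_nat a * ca"
    by (simp add: sa_def ca_def fps_deriv_two_sinh numeral_fps_const fps_of_nat flip: mult.assoc)
  have dR: "2 * fps_deriv R = T"
  proof -
    have "2 * fps_deriv (s C) = of_nat (card C) * c C" for C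
      by (simp add: s_def c_def fps_deriv_two_sinh numeral_fps_const fps_of_nat flip: mult.assoc)
    then show ?thesis
      by (simp add: R_def T_def fps_deriv_prod[OF fin] sum_distrib_left flip: mult.assoc)
  qed
  \<comment> \<open>By the addition formula each join yields a term of \<open>sa * T\<close>, that
    is of the derivative of \<open>R\<close>, and a multiple \<open>card C\<close> of
    \<open>ca * R\<close>; these multiples add up to \<open>card S - a\<close>.\<close>
  have join: "2 * (\<Sum>C \<in> P. of_nat (card C) * two_sinh (of_nat (a + card C)) * prod s (P - {C})) =
      sa * T + of_nat (sum card P) * ca * R"
  proof -
    have "2 * (of_nat (card C) * two_sinh (of_nat (a + card C)) * prod s (P - {C})) =
        sa * (of_nat (card C) * c C * prod s (P - {C})) + of_nat (card C) * ca * R"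
      if "C \<in> P" for C
    proof -
      have "R = s C * prod s (P - {C})"
        unfolding R_def by (rule prod.remove[OF fin that])
      moreover have "2 * two_sinh (of_nat (a + card C)) = sa * c C + ca * s C"
        using two_sinh_add[of "of_nat a" "of_nat (card C)"] by (simp add: sa_def ca_def c_def s_def)
      ultimately have "of_nat (card C) * prod s (P - {C}) * (2 * two_sinh (of_nat (a + card C))) =
          sa * (of_nat (card C) * c C * prod s (P - {C})) + of_nat (card C) * ca * R"
        by (simp only:) (simp add: algebra_simps)
      then show ?thesis by (simp only: mult_ac)
    qed
    then show ?thesis
      by (simp add: sum_distrib_left sum.distrib T_def sum_distrib_right)
  qed
  have sum1: "(\<Sum>i \<in> S - {x}. sinh_prod S (transpose i x \<circ> \<pi>)) =
      (\<Sum>k = 1..<a. two_sinh (of_nat k) * two_sinh (of_nat (a - k))) * R +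
      (\<Sum>C \<in> P. of_nat (card C) * two_sinh (of_nat (a + card C)) * prod s (P - {C}))"
    unfolding a_def P_def R_def s_def by (rule sum_orbit_prod_transpose[OF S \<pi> x])
  have sum2: "(\<Sum>i \<in> {i \<in> S - {x}. \<pi> i = x}. sinh_prod (S - {i}) (transpose i x \<circ> \<pi>)) =
      two_sinh (of_nat a - 1) * R"
    using sum_orbit_prod_transpose_fixed[OF S \<pi> x, of "\<lambda>k. two_sinh (of_nat k)"] a
    by (simp add: a_def P_def R_def s_def of_nat_diff)
  have split: "u * (\<Sum>k = 1..<a. two_sinh (of_nat k) * two_sinh (of_nat (a - k))) =
      (of_nat a - 1) * u * ca - 2 * two_sinh (of_nat a - 1)"
    using sum_two_sinh_mult[OF a] a by (simp add: u_def ca_def of_nat_diff)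
  have prev: "2 * two_sinh (of_nat a - 1) = sa * two_cosh 1 - ca * u"
    using two_sinh_diff[of "of_nat a" 1] by (simp add: sa_def ca_def u_def)
  have "2 * (of_nat (card S) * fps_deriv u * (sa * R) + u * fps_deriv (sa * R)
      - 2 * fps_deriv u * (sa * R)) =
    2 * (u * ((\<Sum>k = 1..<a. two_sinh (of_nat k) * two_sinh (of_nat (a - k))) * R +
      (\<Sum>C \<in> P. of_nat (card C) * two_sinh (of_nat (a + card C)) * prod s (P - {C}))) +
    of_nat (card S) * (two_sinh (of_nat a - 1) * R))" (is "2 * ?l = 2 * ?r")
    unfolding card_S of_nat_add fps_deriv_mult
    by (rule sinh_ode_ring_identity[OF du dsa dR join[unfolded of_nat_add] split prev])
  moreover have "(2 :: complex fps) \<noteq> 0" by simp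
  ultimately have "?l = ?r" by (rule mult_left_cancel[THEN iffD1, rotated])
  then show ?thesis unfolding sum1 sum2 P_eq u_def .
qed

text \<open>The subdegree of \<open>two_sinh 1\<close> is 1, so it is \<open>fps_X\<close> times a
  unit.\<close>

lemma two_sinh_1_dvd:
  assumes "fps_nth f 0 = 0"
  shows "two_sinh 1 dvd f"
proof (cases "f = 0")
  case False
  have "subdegree (two_sinh 1) = 1" by (rule subdegreeI) (simp_all add: two_sinh_def)
  moreover have "1 \<le> subdegree f" by (rule subdegree_geI) (use False assms in auto)
  ultimately show ?thesis using False by (simp add: fps_dvd_iff)
qed simp

section \<open>The generating function and its recursion\<close>

text \<open>The exponent \<open>n - 2\<close> is expressed by a division by the square, so that
  \<open>n = 1\<close> is covered too.\<close>

definition star_egf :: "'a set \<Rightarrow> ('a \<Rightarrow> 'a) \<Rightarrow> complex fps" where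
  "star_egf S \<pi> =
    fps_const (1 / fact (card S)) * ((two_sinh 1 ^ card S * sinh_prod S \<pi>) div two_sinh 1 ^ 2)"

text \<open>The division in \<open>star_egf\<close> is exact: one factor \<open>two_sinh 1\<close>
  divides the power, as \<open>S\<close> is nonempty, and one divides the factor of the cycle of
  \<open>x\<close>.\<close>

lemma star_egf_mult:
  assumes "finite S" "x \<in> S"
  shows "two_sinh 1 ^ 2 * (of_nat (fact (card S)) * star_egf S \<pi>) = two_sinh 1 ^ card S * sinh_prod S \<pi>"
proof -
  have "0 < card S" using assms card_gt_0_iff by blast
  then have "two_sinh 1 dvd two_sinh 1 ^ card S" by (intro dvd_power) auto
  moreover have "two_sinh 1 dvd sinh_prod S \<pi>"
    unfolding orbit_prod_remove[OF assms] by (intro dvd_mult2 two_sinh_1_dvd) simp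
  ultimately have "two_sinh 1 ^ 2 dvd two_sinh 1 ^ card S * sinh_prod S \<pi>"
    unfolding power2_eq_square by (rule mult_dvd_mono)
  then have "two_sinh 1 ^ 2 * ((two_sinh 1 ^ card S * sinh_prod S \<pi>) div two_sinh 1 ^ 2) =
      two_sinh 1 ^ card S * sinh_prod S \<pi>"
    by (rule dvd_mult_div_cancel)
  moreover have "of_nat (fact (card S)) * star_egf S \<pi> =
      (two_sinh 1 ^ card S * sinh_prod S \<pi>) div two_sinh 1 ^ 2"
    by (simp add: star_egf_def flip: fps_of_nat mult.assoc)
  ultimately show ?thesis by simp
qed

text \<open>The initial value of the recursion, to be matched with the empty word. For at least two
  points the exponent \<open>card S - 2\<close> is a true difference, and the cycle of
  \<open>x\<close> contributes a factor without constant term.\<close>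

lemma star_egf_nth_0:
  assumes "finite S" "x \<in> S" "\<pi> permutes S"
  shows "fps_nth (star_egf S \<pi>) 0 = (if S = {x} then 1 else 0)"
proof (cases "S = {x}")
  case True
  have "orbit \<pi> x = {x}" using True permutes_orbit_subset[OF assms(3,2)] orbit_nonempty[of \<pi> x] by blast
  then have "sinh_prod S \<pi> = two_sinh 1" using True by (simp add: orbit_prod_def)
  then have "star_egf S \<pi> = 1"
    using star_egf_mult[OF assms(1,2), of \<pi>] True by (simp add: power2_eq_square)
  then show ?thesis using True by simp
next
  case False
  have "\<not> card S \<le> 1"
    using False assms(1,2) by (auto simp: card_le_Suc0_iff_eq)
  then have "card S = 2 + (card S - 2)" by simp
  then have "two_sinh 1 ^ card S = two_sinh 1 ^ 2 * two_sinh 1 ^ (card S - 2)"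
    by (metis power_add)
  then have "two_sinh 1 ^ 2 * (of_nat (fact (card S)) * star_egf S \<pi>) =
      two_sinh 1 ^ 2 * (two_sinh 1 ^ (card S - 2) * sinh_prod S \<pi>)"
    using star_egf_mult[OF assms(1,2), of \<pi>] by (simp add: mult.assoc)
  then have "of_nat (fact (card S)) * star_egf S \<pi> = two_sinh 1 ^ (card S - 2) * sinh_prod S \<pi>"
    by simp
  from arg_cong[OF this, of "\<lambda>f. fps_nth f 0"] have "fps_nth (star_egf S \<pi>) 0 = 0"
    unfolding orbit_prod_remove[OF assms(1,2)] by (simp flip: fps_of_nat)
  then show ?thesis using False by simp
qed

text \<open>Follows from \<open>sinh_prod_ode\<close> times \<open>u ^ n\<close>. The factor
  \<open>u ^ 3 * F\<close>, cancelled at the end, clears the denominators for \<open>S\<close> and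
  for \<open>S - {i}\<close> at once.\<close>

lemma fps_deriv_star_egf:
  assumes "finite S" "x \<in> S" "\<pi> permutes S"
  shows "fps_deriv (star_egf S \<pi>) =
    (\<Sum>i \<in> S - {x}. star_egf S (transpose i x \<circ> \<pi>)) +
    (\<Sum>i \<in> {i \<in> S - {x}. \<pi> i = x}. star_egf (S - {i}) (transpose i x \<circ> \<pi>))"
proof -
  define n where "n = card S"
  define u where "u = two_sinh 1"
  define F where "F = (of_nat (fact n) :: complex fps)"
  define P where "P = sinh_prod S \<pi>"
  define I where "I = {i \<in> S - {x}. \<pi> i = x}"
  let ?t = "\<lambda>i. transpose i x \<circ> \<pi>"
  have n: "0 < n" using assms card_gt_0_iff unfolding n_def by blast
  have G: "u ^ 2 * (F * star_egf S \<tau>) = u ^ n * sinh_prod S \<tau>" for \<tau>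
    unfolding u_def F_def n_def by (rule star_egf_mult[OF assms(1,2)])
  \<comment> \<open>The smaller ground set lacks one factor \<open>u\<close> and one factor
    \<open>n\<close> of the factorial; supplying both yields the common multiplier.\<close>
  have G': "u ^ 3 * F * star_egf (S - {i}) \<tau> = u ^ n * of_nat n * sinh_prod (S - {i}) \<tau>"
    if "i \<in> I" for i \<tau>
  proof -
    have c: "card (S - {i}) = n - 1" using that assms(1) by (simp add: n_def I_def)
    have "u ^ 2 * (of_nat (fact (n - 1)) * star_egf (S - {i}) \<tau>) = u ^ (n - 1) * sinh_prod (S - {i}) \<tau>"
      unfolding u_def c[symmetric] by (rule star_egf_mult[of _ x]) (use assms that I_def in auto)
    then have "u * of_nat n * (u ^ 2 * (of_nat (fact (n - 1)) * star_egf (S - {i}) \<tau>)) =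
        u * of_nat n * (u ^ (n - 1) * sinh_prod (S - {i}) \<tau>)"
      by simp
    moreover have "F = of_nat n * of_nat (fact (n - 1))"
      unfolding F_def using n by (simp only: fact_reduce of_nat_mult of_nat_id)
    moreover have "u ^ n = u * u ^ (n - 1)" using n by (simp add: power_eq_if)
    ultimately show ?thesis by (simp add: power3_eq_cube power2_eq_square mult_ac)
  qed
  \<comment> \<open>The product rule for \<open>u ^ 2 * (F * star_egf S \<pi>)\<close>, solved for
    the derivative of \<open>star_egf\<close>; this product has no division left.\<close>
  have "u ^ 3 * F * fps_deriv (star_egf S \<pi>) =
    u * fps_deriv (u ^ 2 * (F * star_egf S \<pi>)) - 2 * fps_deriv u * (u ^ 2 * (F * star_egf S \<pi>))"
    by (simp add: F_def power3_eq_cube power2_eq_square algebra_simps flip: fps_of_nat)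
  also have "\<dots> = u * (of_nat n * fps_deriv u * u ^ (n - 1) * P + u ^ n * fps_deriv P)
      - 2 * fps_deriv u * (u ^ n * P)"
    unfolding G by (simp add: P_def fps_deriv_power fps_of_nat)
  also have "\<dots> = u ^ n * (of_nat n * fps_deriv u * P + u * fps_deriv P - 2 * fps_deriv u * P)"
    using n by (simp add: power_eq_if algebra_simps)
  also have "\<dots> = u ^ n * (u * (\<Sum>i \<in> S - {x}. sinh_prod S (?t i)) +
      of_nat n * (\<Sum>i \<in> I. sinh_prod (S - {i}) (?t i)))"
    unfolding u_def P_def n_def I_def sinh_prod_ode[OF assms(1,3,2)] ..
  also have "\<dots> = (\<Sum>i \<in> S - {x}. u * (u ^ n * sinh_prod S (?t i))) +
      (\<Sum>i \<in> I. u ^ n * of_nat n * sinh_prod (S - {i}) (?t i))"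
    by (simp add: distrib_left sum_distrib_left mult_ac)
  also have "(\<Sum>i \<in> I. u ^ n * of_nat n * sinh_prod (S - {i}) (?t i)) =
      (\<Sum>i \<in> I. u ^ 3 * F * star_egf (S - {i}) (?t i))"
    by (intro sum.cong refl G'[symmetric])
  also have "(\<Sum>i \<in> S - {x}. u * (u ^ n * sinh_prod S (?t i))) =
      (\<Sum>i \<in> S - {x}. u ^ 3 * F * star_egf S (?t i))"
    by (simp add: G[symmetric] power3_eq_cube power2_eq_square mult_ac)
  finally have "u ^ 3 * F * fps_deriv (star_egf S \<pi>) = u ^ 3 * F *
      ((\<Sum>i \<in> S - {x}. star_egf S (?t i)) + (\<Sum>i \<in> I. star_egf (S - {i}) (?t i)))"
    by (simp only: distrib_left sum_distrib_left)
  moreover have "u ^ 3 * F \<noteq> 0" by (simp add: u_def F_def flip: fps_of_nat)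
  ultimately show ?thesis unfolding I_def by simp
qed

section \<open>Counting words of star transpositions\<close>

text \<open>Demanding that all letters of \<open>A\<close> occur encodes transitivity, by
  \<open>generates_transitive_star\<close>. Here \<open>c\<close> stands for \<open>n\<close>, and
  \<open>A\<close> is arbitrary because the recursion removes letters.\<close>

definition star_words :: "'a set \<Rightarrow> 'a \<Rightarrow> nat \<Rightarrow> ('a \<Rightarrow> 'a) \<Rightarrow> 'a list set" where
  "star_words A c r \<pi> =
    {is. set is = A \<and> length is = r \<and> foldr (\<circ>) (map (\<lambda>i. transpose i c) is) id = \<pi>}"

lemma finite_star_words: "finite A \<Longrightarrow> finite (star_words A c r \<pi>)"
  by (rule finite_subset[OF _ finite_lists_length_eq[of A r]]) (auto simp: star_words_def)

text \<open>A transposition is its own inverse, so the first letter moves to the other side of the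
  equation. The two letter sets record whether that letter occurs again.\<close>

lemma star_words_Suc:
  "star_words A c (Suc r) \<pi> = (\<Union>i \<in> A. Cons i `
    (star_words A c r (transpose i c \<circ> \<pi>) \<union> star_words (A - {i}) c r (transpose i c \<circ> \<pi>)))"
proof -
  have inv: "transpose i c \<circ> f = \<pi> \<longleftrightarrow> f = transpose i c \<circ> \<pi>" for i f
    by (auto simp flip: comp_assoc)
  show ?thesis
  proof (intro equalityI subsetI)
    fix w assume w: "w \<in> star_words A c (Suc r) \<pi>"
    then obtain i v where v: "w = i # v" by (cases w) (auto simp: star_words_def)
    then have "i \<in> A" "set v = A \<or> set v = A - {i}" using w by (auto simp: star_words_def)
    then show "w \<in> (\<Union>i \<in> A. Cons i `
        (star_words A c r (transpose i c \<circ> \<pi>) \<union> star_words (A - {i}) c r (transpose i c \<circ> \<pi>)))"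
      using w v inv by (auto simp: star_words_def)
  next
    fix w assume "w \<in> (\<Union>i \<in> A. Cons i `
        (star_words A c r (transpose i c \<circ> \<pi>) \<union> star_words (A - {i}) c r (transpose i c \<circ> \<pi>)))"
    then show "w \<in> star_words A c (Suc r) \<pi>"
      using inv by (auto simp: star_words_def)
  qed
qed

lemma star_words_fixes:
  assumes "w \<in> star_words A c r \<pi>" "i \<notin> A" "i \<noteq> c"
  shows "\<pi> i = i"
proof -
  have "foldr (\<circ>) (map (\<lambda>i. transpose i c) w) id i = i" if "i \<notin> set w" for w
    using that assms(3) by (induction w) (auto simp: transpose_def)
  then show ?thesis using assms by (auto simp: star_words_def)
qed

text \<open>A word without \<open>i\<close> has a product fixing \<open>i\<close>. So
  \<open>transpose i c \<circ> \<pi>\<close> can be such a product only if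
  \<open>\<pi> i = c\<close>, which restricts the second sum.\<close>

lemma card_star_words_Suc:
  assumes "finite A" "c \<notin> A"
  shows "card (star_words A c (Suc r) \<pi>) =
    (\<Sum>i \<in> A. card (star_words A c r (transpose i c \<circ> \<pi>))) +
    (\<Sum>i \<in> {i \<in> A. \<pi> i = c}. card (star_words (A - {i}) c r (transpose i c \<circ> \<pi>)))"
proof -
  let ?t = "\<lambda>i. transpose i c \<circ> \<pi>"
  have fin: "finite (star_words A c r \<tau>)" "finite (star_words (A - {i}) c r \<tau>)" for i \<tau>
    using assms by (simp_all add: finite_star_words)
  have "card (star_words A c (Suc r) \<pi>) =
      (\<Sum>i \<in> A. card (Cons i ` (star_words A c r (?t i) \<union> star_words (A - {i}) c r (?t i))))"
    unfolding star_words_Suc by (rule card_UN_disjoint) (use assms fin in auto)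
  also have "\<dots> = (\<Sum>i \<in> A. card (star_words A c r (?t i) \<union> star_words (A - {i}) c r (?t i)))"
    by (simp add: card_image)
  also have "\<dots> = (\<Sum>i \<in> A. card (star_words A c r (?t i)) + card (star_words (A - {i}) c r (?t i)))"
    by (intro sum.cong refl card_Un_disjoint fin) (auto simp: star_words_def)
  also have "\<dots> = (\<Sum>i \<in> A. card (star_words A c r (?t i))) +
      (\<Sum>i \<in> A. card (star_words (A - {i}) c r (?t i)))"
    by (rule sum.distrib)
  also have "(\<Sum>i \<in> A. card (star_words (A - {i}) c r (?t i))) =
      (\<Sum>i \<in> {i \<in> A. \<pi> i = c}. card (star_words (A - {i}) c r (?t i)))"
  proof (rule sum.mono_neutral_right)
    show "\<forall>i \<in> A - {i \<in> A. \<pi> i = c}. card (star_words (A - {i}) c r (?t i)) = 0"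
    proof
      fix i assume i: "i \<in> A - {i \<in> A. \<pi> i = c}"
      have "star_words (A - {i}) c r (?t i) = {}"
      proof (rule ccontr)
        assume "star_words (A - {i}) c r (?t i) \<noteq> {}"
        then obtain w where "w \<in> star_words (A - {i}) c r (?t i)" by blast
        from star_words_fixes[OF this, of i] have "?t i i = i" using i assms(2) by auto
        then have "\<pi> i = c" by (auto simp: transpose_def split: if_splits)
        then show False using i by simp
      qed
      then show "card (star_words (A - {i}) c r (?t i)) = 0" by simp
    qed
  qed (use assms in auto)
  finally show ?thesis .
qed

text \<open>Both sides satisfy the same recursion: \<open>card_star_words_Suc\<close> for the words,
  and coefficient \<open>r\<close> of \<open>fps_deriv_star_egf\<close> for the series. The
  induction on \<open>r\<close> must leave \<open>A\<close> and \<open>\<pi>\<close> free.\<close>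

theorem card_star_words:
  assumes "finite A" "c \<notin> A" "\<pi> permutes insert c A"
  shows "of_nat (card (star_words A c r \<pi>)) = fact r * fps_nth (star_egf (insert c A) \<pi>) r"
  using assms
proof (induction r arbitrary: A \<pi>)
  case 0
  have "star_words A c 0 \<pi> = (if A = {} then {[]} else {})"
    using 0 by (auto simp: star_words_def permutes_sing)
  moreover have "insert c A = {c} \<longleftrightarrow> A = {}" using 0 by auto
  ultimately show ?case using star_egf_nth_0[of "insert c A" c \<pi>] 0 by simp
next
  case (Suc r)
  let ?S = "insert c A" and ?t = "\<lambda>i. transpose i c \<circ> \<pi>"
  have t: "?t i permutes ?S" if "i \<in> A" for i
    by (intro permutes_compose[OF Suc.prems(3)] permutes_swap_id) (use that in auto)
  \<comment> \<open>Since \<open>\<pi> i = c\<close>, the product fixes \<open>i\<close> and so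
    permutes the smaller set.\<close>
  have t': "?t i permutes insert c (A - {i})" if "i \<in> A" "\<pi> i = c" for i
    by (rule permutes_superset[OF t[OF that(1)]]) (use that Suc.prems in auto)
  have S: "?S - {c} = A" using Suc.prems by auto
  have Si: "?S - {i} = insert c (A - {i})" if "i \<in> A" for i using Suc.prems that by auto
  have IH1: "of_nat (card (star_words A c r (?t i))) = fact r * fps_nth (star_egf ?S (?t i)) r"
    if "i \<in> A" for i
    by (rule Suc.IH[OF Suc.prems(1,2) t[OF that]])
  have IH2: "of_nat (card (star_words (A - {i}) c r (?t i))) =
      fact r * fps_nth (star_egf (?S - {i}) (?t i)) r" if "i \<in> A" "\<pi> i = c" for i
    unfolding Si[OF that(1)] by (rule Suc.IH[OF _ _ t'[OF that]]) (use Suc.prems in auto)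
  have "of_nat (card (star_words A c (Suc r) \<pi>)) =
      (\<Sum>i \<in> A. of_nat (card (star_words A c r (?t i)))) +
      (\<Sum>i \<in> {i \<in> A. \<pi> i = c}. of_nat (card (star_words (A - {i}) c r (?t i))) :: complex)"
    by (simp add: card_star_words_Suc[OF Suc.prems(1,2)])
  also have "\<dots> = (\<Sum>i \<in> A. fact r * fps_nth (star_egf ?S (?t i)) r) +
      (\<Sum>i \<in> {i \<in> A. \<pi> i = c}. fact r * fps_nth (star_egf (?S - {i}) (?t i)) r)"
    by (intro arg_cong2[of _ _ _ _ "(+)"] sum.cong refl) (use IH1 IH2 in auto)
  also have "\<dots> = fact r * fps_nth (fps_deriv (star_egf ?S \<pi>)) r"
    using fps_deriv_star_egf[of ?S c \<pi>] Suc.prems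
    by (simp add: S fps_sum_nth distrib_left sum_distrib_left)
  also have "\<dots> = fact (Suc r) * fps_nth (star_egf ?S \<pi>) (Suc r)"
    by (simp add: fact_Suc mult_ac)
  finally show ?case .
qed

section \<open>The generating function of \<open>Q\<close>\<close>

lemma finite_partitions_of: "finite (partitions_of n)"
proof (rule finite_subset)
  show "partitions_of n \<subseteq> {xs. set xs \<subseteq> {..n} \<and> length xs \<le> n}"
  proof
    fix xs assume "xs \<in> partitions_of n"
    then have xs: "\<forall>a \<in> set xs. 1 \<le> a" "sum_list xs = n" by (auto simp: partitions_of_def)
    have "length xs \<le> sum_list xs" using xs(1) by (induction xs) auto
    moreover have "a \<le> sum_list xs" if "a \<in> set xs" for a by (intro member_le_sum_list) (use that in auto)
    ultimately show "xs \<in> {xs. set xs \<subseteq> {..n} \<and> length xs \<le> n}" using xs(2) by auto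
  qed
qed (rule finite_lists_length_le, simp)

lemma card_Aut_superset:
  assumes "finite T" "set \<beta> \<subseteq> T"
  shows "card_Aut \<beta> = (\<Prod>j \<in> T. fact (count_list \<beta> j))"
  unfolding card_Aut_def using assms by (intro prod.mono_neutral_left) (auto simp: count_list_0_iff)

lemma count_list_insort: "count_list (insort j \<beta>) i = count_list (j # \<beta>) i"
  by (induction \<beta>) auto

text \<open>Only the factor of \<open>j\<close> changes, from the factorial of its multiplicity to
  the next factorial.\<close>

lemma card_Aut_insort: "card_Aut (insort j \<beta>) = count_list (insort j \<beta>) j * card_Aut \<beta>"
proof -
  let ?T = "insert j (set \<beta>)"
  have "card_Aut (insort j \<beta>) = (\<Prod>i \<in> ?T. fact (count_list (j # \<beta>) i))"
    by (subst card_Aut_superset[of ?T]) (auto simp: set_insort_key count_list_insort)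
  also have "\<dots> = fact (Suc (count_list \<beta> j)) * (\<Prod>i \<in> ?T - {j}. fact (count_list \<beta> i))"
    by (subst prod.remove[of _ j]) (auto intro!: prod.cong)
  also have "\<dots> = Suc (count_list \<beta> j) * (\<Prod>i \<in> ?T. fact (count_list \<beta> i))"
    by (subst (2) prod.remove[of _ j]) (auto simp: algebra_simps)
  also have "(\<Prod>i \<in> ?T. fact (count_list \<beta> i)) = card_Aut \<beta>"
    by (rule card_Aut_superset[symmetric]) auto
  finally show ?thesis by (simp add: count_list_insort)
qed

text \<open>The coefficient of \<open>x^g\<close> in the exponential of
  \<open>\<Sum>j\<ge>1. c j x^j\<close>.\<close>

definition partition_sum :: "(nat \<Rightarrow> 'a::field_char_0) \<Rightarrow> nat \<Rightarrow> 'a" where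
  "partition_sum c g = (\<Sum>\<beta> \<in> partitions_of g. (\<Prod>b\<leftarrow>\<beta>. c b) / of_nat (card_Aut \<beta>))"

lemma partition_sum_0: "partition_sum c 0 = 1"
proof -
  have "partitions_of 0 = {[]}"
  proof -
    have "xs = []" if "xs \<in> partitions_of 0" for xs
      using that by (cases xs) (auto simp: partitions_of_def)
    then show ?thesis by (auto simp: partitions_of_def)
  qed
  then show ?thesis by (simp add: partition_sum_def card_Aut_def)
qed

lemma prod_list_map_insort:
  fixes c :: "'b::linorder \<Rightarrow> 'a::comm_monoid_mult"
  shows "(\<Prod>b\<leftarrow>insort j \<beta>. c b) = c j * (\<Prod>b\<leftarrow>\<beta>. c b)"
  by (induction \<beta>) (auto simp: mult.left_commute)

lemma sum_list_insort: "sum_list (insort j \<beta>) = j + sum_list (\<beta> :: nat list)"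
  by (induction \<beta>) auto

text \<open>Write \<open>g\<close> as the sum of the parts \<open>j\<close> of
  \<open>\<beta>\<close>, weighted by multiplicity, and exchange the sums. Removing one part
  \<open>j\<close> absorbs the multiplicity into \<open>card_Aut\<close> and releases the factor
  \<open>c j\<close>.\<close>

lemma partition_sum_rec:
  fixes c :: "nat \<Rightarrow> 'a::field_char_0"
  shows "of_nat g * partition_sum c g = (\<Sum>j = 1..g. of_nat j * c j * partition_sum c (g - j))"
proof -
  define w where "w \<beta> = (\<Prod>b\<leftarrow>\<beta>. c b) / of_nat (card_Aut \<beta>)" for \<beta>
  have "of_nat g * w \<beta> = (\<Sum>j \<in> {j \<in> {1..g}. j \<in> set \<beta>}. of_nat (j * count_list \<beta> j) * w \<beta>)"
    if "\<beta> \<in> partitions_of g" for \<beta>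
  proof -
    have "g = sum_list (map id \<beta>)" using that by (simp add: partitions_of_def)
    also have "\<dots> = (\<Sum>j \<in> set \<beta>. j * count_list \<beta> j)"
      by (subst sum_list_map_eq_sum_count) (simp add: mult.commute)
    finally have "of_nat g = (\<Sum>j \<in> set \<beta>. of_nat (j * count_list \<beta> j) :: 'a)"
      by (metis of_nat_sum)
    moreover have "set \<beta> = {j \<in> {1..g}. j \<in> set \<beta>}"
      using that member_le_sum_list by (auto simp: partitions_of_def)
    ultimately show ?thesis by (simp only: sum_distrib_right)
  qed
  then have "of_nat g * partition_sum c g =
      (\<Sum>\<beta> \<in> partitions_of g. \<Sum>j \<in> {j \<in> {1..g}. j \<in> set \<beta>}. of_nat (j * count_list \<beta> j) * w \<beta>)"
    by (simp add: partition_sum_def w_def sum_distrib_left)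
  also have "\<dots> = (\<Sum>j = 1..g. \<Sum>\<beta> \<in> {\<beta> \<in> partitions_of g. j \<in> set \<beta>}. of_nat (j * count_list \<beta> j) * w \<beta>)"
    by (rule sum.swap_restrict) (auto simp: finite_partitions_of)
  also have "\<dots> = (\<Sum>j = 1..g. of_nat j * c j * partition_sum c (g - j))"
  proof (rule sum.cong[OF refl])
    fix j assume j: "j \<in> {1..g}"
    have "(\<Sum>\<beta> \<in> {\<beta> \<in> partitions_of g. j \<in> set \<beta>}. of_nat (j * count_list \<beta> j) * w \<beta>) =
      (\<Sum>\<beta> \<in> partitions_of (g - j). of_nat j * c j * w \<beta>)"
    proof (rule sum.reindex_bij_witness[where i = "insort j" and j = "remove1 j"])
      fix \<beta> assume \<beta>: "\<beta> \<in> {\<beta> \<in> partitions_of g. j \<in> set \<beta>}"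
      then show eq: "insort j (remove1 j \<beta>) = \<beta>"
        by (intro insort_remove1) (auto simp: partitions_of_def)
      have "sum_list (remove1 j \<beta>) = g - j"
        using sum_list_insort[of j "remove1 j \<beta>"] \<beta> unfolding eq by (auto simp: partitions_of_def)
      then show "remove1 j \<beta> \<in> partitions_of (g - j)"
        using \<beta> set_remove1_subset[of j \<beta>] by (auto simp: partitions_of_def sorted_remove1)
      define n where "n = count_list \<beta> j"
      have n: "n \<noteq> 0" using \<beta> by (simp add: n_def count_list_0_iff)
      \<comment> \<open>\<open>\<beta>\<close> is read as
        \<open>insort j (remove1 j \<beta>)\<close>, so that the insertion rules for the product and
        for \<open>card_Aut\<close> apply.\<close>
      have "w \<beta> = c j * (\<Prod>b\<leftarrow>remove1 j \<beta>. c b) / of_nat (n * card_Aut (remove1 j \<beta>))"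
        unfolding w_def n_def using prod_list_map_insort[of c j "remove1 j \<beta>"] card_Aut_insort[of j "remove1 j \<beta>"]
        by (simp only: eq)
      then show "of_nat j * c j * w (remove1 j \<beta>) = of_nat (j * count_list \<beta> j) * w \<beta>"
        using n unfolding n_def[symmetric] by (simp add: w_def)
    next
      fix \<beta> assume \<beta>: "\<beta> \<in> partitions_of (g - j)"
      show "remove1 j (insort j \<beta>) = \<beta>" by simp
      show "insort j \<beta> \<in> {\<beta> \<in> partitions_of g. j \<in> set \<beta>}"
        using \<beta> j by (auto simp: partitions_of_def sum_list_insort set_insort_key sorted_insort)
    qed
    then show "(\<Sum>\<beta> \<in> {\<beta> \<in> partitions_of g. j \<in> set \<beta>}. of_nat (j * count_list \<beta> j) * w \<beta>) =
        of_nat j * c j * partition_sum c (g - j)"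
      by (simp add: partition_sum_def w_def sum_distrib_left)
  qed
  finally show ?thesis .
qed

section \<open>Logarithms of formal power series\<close>

text \<open>States \<open>f = exp l\<close>, up to the constant term of \<open>l\<close>, through
  the logarithmic derivative. Products, powers and substitutions then become easy, and
  \<open>l\<close> determines \<open>f\<close>.\<close>

definition is_fps_log :: "complex fps \<Rightarrow> complex fps \<Rightarrow> bool" where
  "is_fps_log f l \<longleftrightarrow> fps_nth f 0 = 1 \<and> fps_deriv f = fps_deriv l * f"

lemma is_fps_log_mult: "is_fps_log f l \<Longrightarrow> is_fps_log g k \<Longrightarrow> is_fps_log (f * g) (l + k)"
  by (simp add: is_fps_log_def algebra_simps)

lemma is_fps_log_1: "is_fps_log 1 0"
  by (simp add: is_fps_log_def)

lemma is_fps_log_power: "is_fps_log f l \<Longrightarrow> is_fps_log (f ^ n) (of_nat n * l)"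
  by (induction n) (simp_all add: is_fps_log_1 is_fps_log_mult distrib_right)

lemma is_fps_log_prod_list:
  assumes "\<And>x. x \<in> set xs \<Longrightarrow> is_fps_log (f x) (l x)"
  shows "is_fps_log (\<Prod>x\<leftarrow>xs. f x) (\<Sum>x\<leftarrow>xs. l x)"
  using assms by (induction xs) (simp_all add: is_fps_log_1 is_fps_log_mult)

lemma is_fps_log_compose:
  assumes "is_fps_log f l" "fps_nth h 0 = 0"
  shows "is_fps_log (f oo h) (l oo h)"
  using assms by (simp add: is_fps_log_def fps_compose_deriv fps_compose_mult_distrib mult_ac)

text \<open>The difference solves the linear equation \<open>d' = l' d\<close> with
  \<open>d(0) = 0\<close>; each of its coefficients is a combination of earlier ones, hence
  zero.\<close>

lemma is_fps_log_unique:
  assumes "is_fps_log f l" "is_fps_log g l"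
  shows "f = g"
proof (rule fps_ext)
  define d where "d = f - g"
  have d0: "fps_nth d 0 = 0" and d': "fps_deriv d = fps_deriv l * d"
    using assms by (simp_all add: is_fps_log_def d_def algebra_simps)
  have "fps_nth d n = 0" for n
  proof (induction n rule: less_induct)
    case (less n)
    show ?case
    proof (cases n)
      case (Suc m)
      have "of_nat (Suc m) * fps_nth d (Suc m) = fps_nth (fps_deriv l * d) m"
        by (simp flip: d')
      also have "\<dots> = 0"
        unfolding fps_mult_nth by (rule sum.neutral) (use less Suc in auto)
      finally show ?thesis using Suc by (simp del: of_nat_Suc)
    qed (simp add: d0)
  qed
  then show "fps_nth f n = fps_nth g n" for n by (simp add: d_def)
qed

text \<open>After multiplication by \<open>fps_X\<close>, which removes the index shift of the
  derivative, the differential equation is \<open>partition_sum_rec\<close> read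
  coefficientwise.\<close>

lemma is_fps_log_partition_sum:
  fixes c :: "nat \<Rightarrow> complex"
  shows "is_fps_log (Abs_fps (partition_sum c)) (Abs_fps (\<lambda>j. if j = 0 then 0 else c j))"
    (is "is_fps_log ?P ?C")
proof -
  have "fps_X * fps_deriv ?P = fps_X * (fps_deriv ?C * ?P)"
  proof (rule fps_ext)
    fix g
    have X_deriv: "fps_nth (fps_X * fps_deriv F) k = of_nat k * fps_nth F k" for F :: "complex fps" and k
      by (cases k) auto
    have "fps_nth (fps_X * (fps_deriv ?C * ?P)) g =
        (\<Sum>j = 0..g. of_nat j * fps_nth ?C j * partition_sum c (g - j))"
      by (simp only: mult.assoc[symmetric] fps_mult_nth[of "fps_X * _"] X_deriv) simp
    also have "\<dots> = (\<Sum>j = 1..g. of_nat j * c j * partition_sum c (g - j))"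
      by (rule sum.mono_neutral_cong_right) auto
    also have "\<dots> = fps_nth (fps_X * fps_deriv ?P) g"
      unfolding X_deriv by (simp add: partition_sum_rec)
    finally show "fps_nth (fps_X * fps_deriv ?P) g = fps_nth (fps_X * (fps_deriv ?C * ?P)) g" ..
  qed
  then show ?thesis by (simp add: is_fps_log_def partition_sum_0)
qed

lemma is_fps_log_xi: "is_fps_log xi_series log_xi"
proof -
  have "fps_deriv log_xi = (inverse (1 + fps_X) oo (xi_series - 1)) * fps_deriv xi_series"
    unfolding log_xi_def by (simp add: fps_compose_deriv fps_ln_deriv)
  also have "inverse (1 + fps_X) oo (xi_series - 1) = inverse ((1 + fps_X) oo (xi_series - 1))"
    by (rule fps_inverse_compose) simp_all
  also have "(1 + fps_X) oo (xi_series - 1) = xi_series"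
    by (simp add: fps_compose_add_distrib)
  finally have "fps_deriv log_xi * xi_series = fps_deriv xi_series * (inverse xi_series * xi_series)"
    by (simp add: mult_ac)
  also have "inverse xi_series * xi_series = 1" by (rule inverse_mult_eq_1) simp
  finally show ?thesis by (simp add: is_fps_log_def)
qed

section \<open>From hyperbolic sines to the numbers \<open>xi\<close> and the sums
  \<open>Q\<close>\<close>

lemma two_sinh_eq_xi:
  "two_sinh z = fps_const z * fps_X * (xi_series oo (fps_const z * fps_X))"
proof (rule fps_ext)
  fix k
  show "fps_nth (two_sinh z) k =
      fps_nth (fps_const z * fps_X * (xi_series oo (fps_const z * fps_X))) k"
  proof (cases k)
    case (Suc m)
    have "(z / 2) ^ k = z * z ^ m * (1 / 2) ^ k" "(- (z / 2)) ^ k = z * z ^ m * (- (1 / 2)) ^ k"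
      using power_mult_distrib[of z "1 / 2" k] power_mult_distrib[of z "- (1 / 2)" k] Suc by simp_all
    moreover have "fps_nth (fps_const z * fps_X * (xi_series oo (fps_const z * fps_X))) k =
        z * (z ^ m * fps_nth xi_series m)"
      by (simp only: Suc mult.assoc fps_mult_left_const_nth fps_X_mult_nth fps_nth_compose_linear) simp
    ultimately show ?thesis
      by (simp add: two_sinh_def xi_series_nth Suc mult.assoc right_diff_distrib diff_divide_distrib
          del: power_Suc fact_Suc)
  qed (simp add: mult.assoc)
qed

lemma xi_odd: "odd k \<Longrightarrow> xi k = 0"
  and xi_0: "xi 0 = 0"
  using arg_cong[OF xi_generating_function, of "\<lambda>f. fps_nth f k"]
    arg_cong[OF xi_generating_function, of "\<lambda>f. fps_nth f 0"]
  by (simp_all add: xi_def)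

lemma Q_eq_partition_sum: "Q g \<alpha> = partition_sum (\<lambda>j. xi (2 * j) * q (2 * j) \<alpha>) g"
proof -
  have "(\<Prod>b\<leftarrow>\<beta>. xi (2 * b)) * (\<Prod>b\<leftarrow>\<beta>. q (2 * b) \<alpha>) = (\<Prod>b\<leftarrow>\<beta>. xi (2 * b) * q (2 * b) \<alpha>)" for \<beta>
    by (induction \<beta>) (simp_all add: mult_ac)
  then show ?thesis by (simp add: Q_def partition_sum_def)
qed

text \<open>Both sides have the same logarithm: its coefficient at \<open>x^k\<close> is
  \<open>xi k\<close> times \<open>2 + q k \<alpha>\<close> on the left and times
  \<open>p_1 + p_k\<close> on the right. The square on the left replaces an exponent
  \<open>n - 2\<close>, which is negative for \<open>n = 1\<close>.\<close>

lemma Q_generating_function: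
  fixes \<alpha> :: "nat list"
  defines "B \<equiv> Abs_fps (\<lambda>g. Q g \<alpha>) oo fps_X ^ 2"
  shows "xi_series ^ 2 * B =
    xi_series ^ sum_list \<alpha> * (\<Prod>a\<leftarrow>\<alpha>. xi_series oo (fps_const (of_nat a) * fps_X))"
proof -
  let ?C = "Abs_fps (\<lambda>j. if j = 0 then 0 else xi (2 * j) * q (2 * j) \<alpha>) oo fps_X ^ 2"
  let ?L = "\<lambda>a. log_xi oo (fps_const (of_nat a) * fps_X)"
  have "is_fps_log B ?C"
    unfolding B_def Q_eq_partition_sum by (intro is_fps_log_compose is_fps_log_partition_sum) simp
  then have 1: "is_fps_log (xi_series ^ 2 * B) (of_nat 2 * log_xi + ?C)"
    by (intro is_fps_log_mult is_fps_log_power is_fps_log_xi)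
  have 2: "is_fps_log (xi_series ^ sum_list \<alpha> * (\<Prod>a\<leftarrow>\<alpha>. xi_series oo (fps_const (of_nat a) * fps_X)))
      (of_nat (sum_list \<alpha>) * log_xi + (\<Sum>a\<leftarrow>\<alpha>. ?L a))"
    by (intro is_fps_log_mult is_fps_log_power is_fps_log_xi is_fps_log_prod_list is_fps_log_compose) simp
  have "of_nat 2 * log_xi + ?C = of_nat (sum_list \<alpha>) * log_xi + (\<Sum>a\<leftarrow>\<alpha>. ?L a)"
  proof (rule fps_ext)
    fix k
    have L: "fps_nth (\<Sum>a\<leftarrow>\<alpha>. ?L a) k = power_sum k \<alpha> * xi k"
      by (induction \<alpha>) (simp_all add: power_sum_def xi_def distrib_right)
    have n: "of_nat (sum_list \<alpha>) = power_sum 1 \<alpha>"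
      by (induction \<alpha>) (simp_all add: power_sum_def)
    \<comment> \<open>The series \<open>?C\<close> has only even powers of positive degree; at the
      other degrees \<open>xi k\<close> vanishes, so the formula holds for all
      \<open>k\<close>.\<close>
    have C: "fps_nth ?C k = xi k * q k \<alpha>"
      by (cases "k = 0"; cases "even k") (auto simp: fps_nth_compose_X_power xi_odd xi_0)
    show "fps_nth (of_nat 2 * log_xi + ?C) k =
        fps_nth (of_nat (sum_list \<alpha>) * log_xi + (\<Sum>a\<leftarrow>\<alpha>. ?L a)) k"
      unfolding fps_add_nth L C
      by (simp add: n q_def algebra_simps flip: fps_of_nat xi_def)
  qed
  then show ?thesis using is_fps_log_unique[OF 1] 2 by simp
qed

section \<open>Coefficients of the transitive powers\<close>

lemma mset_cycle_type: "mset (cycle_type n \<pi>) = image_mset card (mset_set (orbit \<pi> ` {1..n}))"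
  by (simp add: cycle_type_def)

lemma prod_list_cycle_type: "(\<Prod>a\<leftarrow>cycle_type n \<pi>. h a) = orbit_prod h {1..n} \<pi>"
proof -
  have "(\<Prod>a\<leftarrow>cycle_type n \<pi>. h a) = prod_mset (image_mset h (mset (cycle_type n \<pi>)))"
    by (simp flip: prod_mset_prod_list)
  then show ?thesis
    by (simp add: mset_cycle_type orbit_prod_def prod_unfold_prod_mset multiset.map_comp comp_def)
qed

lemma cycle_type_in_partitions:
  assumes "\<pi> permutes {1..n}"
  shows "cycle_type n \<pi> \<in> partitions_of n"
proof -
  have "sum_list (cycle_type n \<pi>) = sum card (orbit \<pi> ` {1..n})"
    by (simp add: sum_mset_sum_list[symmetric] mset_cycle_type sum_unfold_sum_mset)
  also have "\<dots> = n" using sum_card_orbits[OF _ assms] by simp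
  finally have sum: "sum_list (cycle_type n \<pi>) = n" .
  have pos: "1 \<le> a" if "a \<in> set (cycle_type n \<pi>)" for a
  proof -
    have "a \<in># mset (cycle_type n \<pi>)" using that by simp
    then obtain x where x: "x \<in> {1..n}" "a = card (orbit \<pi> x)"
      unfolding mset_cycle_type by auto
    have "finite (orbit \<pi> x)" using permutes_orbit_subset[OF assms x(1)] finite_subset by blast
    then show ?thesis using x(2) orbit_nonempty[of \<pi> x] card_gt_0_iff[of "orbit \<pi> x"] by simp
  qed
  have "sorted (cycle_type n \<pi>)" by (simp add: cycle_type_def)
  then show ?thesis using sum pos by (simp add: partitions_of_def)
qed

text \<open>Each \<open>two_sinh a\<close> is \<open>a x\<close> times \<open>xi_series\<close> at
  \<open>a x\<close>. The powers of \<open>x\<close> collect to \<open>n + length \<alpha>\<close>,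
  and the square of \<open>two_sinh 1\<close>, that is \<open>x^2\<close> times
  \<open>xi_series ^ 2\<close>, cancels.\<close>

lemma star_egf_eq_Q:
  assumes "1 \<le> n" "\<pi> permutes {1..n}"
  defines "\<alpha> \<equiv> cycle_type n \<pi>"
  shows "of_nat (fact n) * star_egf {1..n} \<pi> =
    fps_const (\<Prod>a\<leftarrow>\<alpha>. of_nat a) * fps_X ^ (n + length \<alpha> - 2) * (Abs_fps (\<lambda>g. Q g \<alpha>) oo fps_X ^ 2)"
    and "2 \<le> n + length \<alpha>"
proof -
  define B where "B = Abs_fps (\<lambda>g. Q g \<alpha>) oo fps_X ^ 2"
  let ?xi = "\<lambda>a. xi_series oo (fps_const (of_nat a) * fps_X)"
  have sum: "sum_list \<alpha> = n"
    using cycle_type_in_partitions[OF assms(2)] by (simp add: partitions_of_def \<alpha>_def)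
  then have "\<alpha> \<noteq> []" using assms(1) by auto
  then show len: "2 \<le> n + length \<alpha>" using assms(1) by (cases \<alpha>) auto
  have u: "two_sinh 1 = fps_X * xi_series" using two_sinh_eq_xi[of 1] by simp
  have "sinh_prod {1..n} \<pi> = (\<Prod>a\<leftarrow>\<alpha>. two_sinh (of_nat a))"
    unfolding \<alpha>_def by (rule prod_list_cycle_type[symmetric])
  also have "\<dots> = fps_const (\<Prod>a\<leftarrow>\<alpha>. of_nat a) * fps_X ^ length \<alpha> * (\<Prod>a\<leftarrow>\<alpha>. ?xi a)"
  proof (induction \<alpha>)
    case (Cons a \<alpha>)
    then show ?case
      using two_sinh_eq_xi[of "of_nat a"] by (simp add: mult_ac flip: fps_const_mult)
  qed simp
  finally have P: "sinh_prod {1..n} \<pi> =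
    fps_const (\<Prod>a\<leftarrow>\<alpha>. of_nat a) * fps_X ^ length \<alpha> * (\<Prod>a\<leftarrow>\<alpha>. ?xi a)" .
  have "(two_sinh 1) ^ 2 * (of_nat (fact n) * star_egf {1..n} \<pi>) = two_sinh 1 ^ n * sinh_prod {1..n} \<pi>"
    using star_egf_mult[of "{1..n}" 1 \<pi>] assms(1) by simp
  also have "\<dots> = fps_const (\<Prod>a\<leftarrow>\<alpha>. of_nat a) * fps_X ^ (n + length \<alpha>) *
      (xi_series ^ n * (\<Prod>a\<leftarrow>\<alpha>. ?xi a))"
    unfolding P u by (simp only: power_mult_distrib power_add mult_ac)
  also have "xi_series ^ n * (\<Prod>a\<leftarrow>\<alpha>. ?xi a) = xi_series ^ 2 * B"
    using Q_generating_function[of \<alpha>] by (simp add: sum B_def)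
  also have "n + length \<alpha> = 2 + (n + length \<alpha> - 2)" using len by simp
  then have "(fps_X :: complex fps) ^ (n + length \<alpha>) = fps_X ^ 2 * fps_X ^ (n + length \<alpha> - 2)"
    by (metis power_add)
  finally have "two_sinh 1 ^ 2 * (of_nat (fact n) * star_egf {1..n} \<pi>) = two_sinh 1 ^ 2 *
      (fps_const (\<Prod>a\<leftarrow>\<alpha>. of_nat a) * fps_X ^ (n + length \<alpha> - 2) * B)"
    unfolding u by (simp only: power_mult_distrib mult_ac)
  moreover have "two_sinh 1 ^ 2 \<noteq> 0" by simp
  ultimately show "of_nat (fact n) * star_egf {1..n} \<pi> =
    fps_const (\<Prod>a\<leftarrow>\<alpha>. of_nat a) * fps_X ^ (n + length \<alpha> - 2) * (Abs_fps (\<lambda>g. Q g \<alpha>) oo fps_X ^ 2)"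
    unfolding B_def by (rule mult_left_cancel[THEN iffD1, rotated])
qed

text \<open>The \<open>Q\<close> series contains only even powers and is shifted by
  \<open>n + length \<alpha> - 2\<close>, so exactly the exponents of the stated form survive.
  Writing \<open>r + 2\<close> avoids truncated subtraction.\<close>

lemma star_egf_nth:
  assumes "1 \<le> n" "\<pi> permutes {1..n}"
  defines "\<alpha> \<equiv> cycle_type n \<pi>"
  shows "n + length \<alpha> + 2 * g = r + 2 \<Longrightarrow> fact r * fps_nth (star_egf {1..n} \<pi>) r = coeff_a g \<alpha>"
    and "\<nexists>g. n + length \<alpha> + 2 * g = r + 2 \<Longrightarrow> fps_nth (star_egf {1..n} \<pi>) r = 0"
proof -
  define d where "d = n + length \<alpha> - 2"
  note len = star_egf_eq_Q(2)[OF assms(1,2), folded \<alpha>_def]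
  have sum: "sum_list \<alpha> = n"
    using cycle_type_in_partitions[OF assms(2)] by (simp add: partitions_of_def \<alpha>_def)
  have "fact n * fps_nth (star_egf {1..n} \<pi>) r = fps_nth (of_nat (fact n) * star_egf {1..n} \<pi>) r"
    by (simp only: fps_of_nat[symmetric] fps_mult_left_const_nth of_nat_fact)
  also have "\<dots> = (\<Prod>a\<leftarrow>\<alpha>. of_nat a) *
      (if r < d then 0 else fps_nth (Abs_fps (\<lambda>g. Q g \<alpha>) oo fps_X ^ 2) (r - d))"
    unfolding star_egf_eq_Q(1)[OF assms(1,2), folded \<alpha>_def]
    by (simp only: mult.assoc fps_mult_left_const_nth fps_X_power_mult_nth d_def)
  finally have nth: "fact n * fps_nth (star_egf {1..n} \<pi>) r = (\<Prod>a\<leftarrow>\<alpha>. of_nat a) *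
      (if r < d \<or> odd (r - d) then 0 else Q ((r - d) div 2) \<alpha>)"
    by (simp add: fps_nth_compose_X_power)
  {
    assume g: "n + length \<alpha> + 2 * g = r + 2"
    then have "r = d + 2 * g" using len by (simp add: d_def)
    then have "fact n * fps_nth (star_egf {1..n} \<pi>) r = (\<Prod>a\<leftarrow>\<alpha>. of_nat a) * Q g \<alpha>"
      using nth by simp
    moreover have "sum_list \<alpha> + length \<alpha> + 2 * g - 2 = r" using g by (simp add: sum)
    ultimately show "fact r * fps_nth (star_egf {1..n} \<pi>) r = coeff_a g \<alpha>"
      by (simp add: coeff_a_def sum field_simps)
  next
    assume no: "\<nexists>g. n + length \<alpha> + 2 * g = r + 2"
    have "r < d \<or> odd (r - d)"
    proof (rule ccontr)
      assume "\<not> (r < d \<or> odd (r - d))"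
      then obtain g where "r = d + 2 * g" by (metis dvdE le_add_diff_inverse not_less)
      then have "n + length \<alpha> + 2 * g = r + 2" using len by (simp add: d_def)
      then show False using no by blast
    qed
    then show "fps_nth (star_egf {1..n} \<pi>) r = 0" using nth by simp
  }
qed

section \<open>Transitivity and the class expansion\<close>

text \<open>A letter that does not occur is fixed by every generator, hence by the whole group, and
  cannot be moved to \<open>n\<close>. Conversely \<open>(y n) (x n)\<close> sends \<open>x\<close>
  to \<open>y\<close>.\<close>

lemma generates_transitive_star:
  assumes "1 \<le> n" "set is \<subseteq> {1..n - 1}"
  shows "generates_transitive n (map (\<lambda>i. transpose i n) is) \<longleftrightarrow> set is = {1..n - 1}"
proof
  let ?H = "generate (sym_group n) (set (map (\<lambda>i. transpose i n) is))"
  have gen: "transpose i n \<in> carrier (sym_group n)" if "i \<in> {1..n}" for i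
    unfolding sym_group_carrier by (rule permutes_swap_id) (use that assms(1) in auto)
  {
    assume trans: "generates_transitive n (map (\<lambda>i. transpose i n) is)"
    have "i \<in> set is" if i: "i \<in> {1..n - 1}" for i
    proof (rule ccontr)
      assume notin: "i \<notin> set is"
      have "\<tau> i = i" if "\<tau> \<in> ?H" for \<tau>
        using that
      proof (induction rule: generate.induct)
        case (incl h)
        then show ?case using notin i by (auto simp: transpose_def)
      next
        case (inv h)
        then obtain j where j: "j \<in> set is" "h = transpose j n" by auto
        then have "inv\<^bsub>sym_group n\<^esub> h = transpose j n"
          using gen[of j] subsetD[OF assms(2) j(1)] by (subst sym_group_inv_equality) auto
        then show ?case using j notin i by (auto simp: transpose_def)
      qed (auto simp: sym_group_one sym_group_mult)
      moreover have "i \<in> {1..n}" "n \<in> {1..n}" "i \<noteq> n" using i assms(1) by auto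
      ultimately show False using trans unfolding generates_transitive_def by metis
    qed
    then show "set is = {1..n - 1}" using assms(2) by blast
  next
    assume all: "set is = {1..n - 1}"
    \<comment> \<open>Including \<open>i = n\<close>, where the transposition is the identity,
      treats \<open>x\<close> or \<open>y\<close> equal to \<open>n\<close>, and the trivial group
      for \<open>n = 1\<close>, without extra cases.\<close>
    have t: "transpose i n \<in> ?H" if "i \<in> {1..n}" for i
    proof (cases "i = n")
      case True
      then show ?thesis using generate.one[of "sym_group n"] by (simp add: sym_group_one)
    next
      case False
      then show ?thesis using that all by (intro generate.incl) auto
    qed
    show "generates_transitive n (map (\<lambda>i. transpose i n) is)"
      unfolding generates_transitive_def
    proof (intro ballI)
      fix x y assume "x \<in> {1..n}" "y \<in> {1..n}"
      then have "transpose y n \<otimes>\<^bsub>sym_group n\<^esub> transpose x n \<in> ?H"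
        by (intro generate.eng t)
      moreover have "(transpose y n \<otimes>\<^bsub>sym_group n\<^esub> transpose x n) x = y"
        by (simp add: sym_group_mult)
      ultimately show "\<exists>\<tau> \<in> ?H. \<tau> x = y" by blast
    qed
  }
qed

lemma trans_power_eq_card:
  assumes "1 \<le> n"
  shows "trans_power n r \<pi> = of_nat (card (star_words {1..n - 1} n r \<pi>))"
proof -
  let ?L = "{is. set is \<subseteq> {1..n - 1} \<and> length is = r}"
  have fin: "finite ?L" by (rule finite_lists_length_eq) simp
  have "trans_op n (map (\<lambda>i. transpose i n) w) \<pi> = (if w \<in> star_words {1..n - 1} n r \<pi> then 1 else 0)"
    if "w \<in> ?L" for w
  proof -
    have "generates_transitive n (map (\<lambda>i. transpose i n) w) \<longleftrightarrow> set w = {1..n - 1}"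
      using that by (intro generates_transitive_star[OF assms]) auto
    then show ?thesis
      using that by (auto simp: trans_op_def star_words_def basis_elem_def sym_group_mult sym_group_one)
  qed
  then have "trans_power n r \<pi> = (\<Sum>w \<in> ?L. if w \<in> star_words {1..n - 1} n r \<pi> then 1 else 0)"
    by (simp add: trans_power_def)
  also have "\<dots> = (\<Sum>w \<in> ?L \<inter> star_words {1..n - 1} n r \<pi>. 1)"
    by (rule sum.inter_restrict[OF fin, symmetric])
  also have "?L \<inter> star_words {1..n - 1} n r \<pi> = star_words {1..n - 1} n r \<pi>"
    by (auto simp: star_words_def)
  finally show ?thesis by simp
qed

lemma star_words_permutes:
  assumes "w \<in> star_words A c r \<pi>"
  shows "\<pi> permutes insert c A"
proof -
  have "foldr (\<circ>) (map (\<lambda>i. transpose i c) w) id permutes insert c A" if "set w \<subseteq> A" for w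
    using that
    by (induction w) (auto simp: permutes_id intro!: permutes_compose permutes_swap_id)
  then show ?thesis using assms by (auto simp: star_words_def)
qed

lemma class_sum_eq: "class_sum n \<alpha> \<pi> = (if \<pi> \<in> conj_class n \<alpha> then 1 else 0)"
proof -
  have "finite (conj_class n \<alpha>)"
    by (rule finite_subset[OF _ finite_permutations[of "{1..n}"]])
      (auto simp: conj_class_def sym_group_carrier)
  then show ?thesis by (simp add: class_sum_def basis_elem_def)
qed

text \<open>At a permutation only \<open>\<alpha> = cycle_type n \<pi>\<close> contributes, and
  \<open>r\<close> then determines \<open>g\<close>, if there is one. Outside the group both sides
  are zero.\<close>

lemma trans_power_class_expansion:
  assumes "1 \<le> n"
  shows "trans_power n r \<pi> =
    (\<Sum>(\<alpha>, g) \<in> {(\<alpha>, g). \<alpha> \<in> partitions_of n \<and> n + length \<alpha> + 2 * g = r + 2}.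
      coeff_a g \<alpha> * class_sum n \<alpha> \<pi>)" (is "_ = sum ?f ?I")
proof (cases "\<pi> permutes {1..n}")
  case False
  have "insert n {1..n - 1} = {1..n}" using assms by auto
  then have "star_words {1..n - 1} n r \<pi> = {}"
    using False star_words_permutes[of _ "{1..n - 1}" n r \<pi>] by auto
  moreover have "class_sum n \<alpha> \<pi> = 0" for \<alpha>
    using False by (simp add: class_sum_eq conj_class_def sym_group_carrier)
  ultimately show ?thesis by (simp add: trans_power_eq_card[OF assms] case_prod_unfold)
next
  case True
  let ?ct = "cycle_type n \<pi>"
  have fin: "finite ?I"
    by (rule finite_subset[of _ "partitions_of n \<times> {..r + 2}"]) (auto simp: finite_partitions_of)
  have "insert n {1..n - 1} = {1..n}" using assms by auto
  then have lhs: "trans_power n r \<pi> = fact r * fps_nth (star_egf {1..n} \<pi>) r"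
    using card_star_words[of "{1..n - 1}" n \<pi> r] assms True by (simp add: trans_power_eq_card)
  have cls: "class_sum n \<alpha> \<pi> = (if \<alpha> = ?ct then 1 else 0)" for \<alpha>
    using True by (auto simp: class_sum_eq conj_class_def sym_group_carrier)
  show ?thesis
  proof (cases "\<exists>g. n + length ?ct + 2 * g = r + 2")
    case True
    then obtain g where g: "n + length ?ct + 2 * g = r + 2" by blast
    have "sum ?f ?I = sum ?f {(?ct, g)}"
    proof (rule sum.mono_neutral_right[OF fin])
      show "{(?ct, g)} \<subseteq> ?I" using g cycle_type_in_partitions[OF \<open>\<pi> permutes {1..n}\<close>] by simp
      show "\<forall>p \<in> ?I - {(?ct, g)}. ?f p = 0" using g by (auto simp: cls split: if_splits)
    qed
    then show ?thesis
      using star_egf_nth(1)[OF assms \<open>\<pi> permutes {1..n}\<close> g] by (simp add: lhs cls)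
  next
    case False
    have "sum ?f ?I = 0" by (rule sum.neutral) (use False in \<open>auto simp: cls split: if_splits\<close>)
    then show ?thesis
      using star_egf_nth(2)[OF assms \<open>\<pi> permutes {1..n}\<close> False] by (simp add: lhs)
  qed
qed

section \<open>Centrality\<close>

text \<open>The orbits of the conjugate are the images of the orbits of \<open>\<pi>\<close> under
  the injection \<open>\<rho>\<close>, which keeps them distinct and of the same size.\<close>

lemma cycle_type_conj:
  assumes "\<pi> permutes {1..n}" "\<rho> permutes {1..n}"
  shows "cycle_type n (\<rho> \<circ> \<pi> \<circ> inv' \<rho>) = cycle_type n \<pi>"
proof -
  let ?\<sigma> = "\<rho> \<circ> \<pi> \<circ> inv' \<rho>" and ?S = "{1..n}"
  have perm: "permutation \<pi>" using assms(1) permutation_permutes by blast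
  have inj: "inj \<rho>" using assms(2) by (rule permutes_inj)
  have "orbit ?\<sigma> (\<rho> x) = \<rho> ` orbit \<pi> x" for x
    using permutation_self_in_orbit[OF perm] by (intro orbit_inverse[symmetric]) (auto simp: inj)
  then have "orbit ?\<sigma> ` \<rho> ` ?S = (`) \<rho> ` orbit \<pi> ` ?S"
    by (simp add: image_image)
  then have "orbit ?\<sigma> ` ?S = (`) \<rho> ` orbit \<pi> ` ?S"
    unfolding permutes_image[OF assms(2)] .
  moreover have "inj_on ((`) \<rho>) (orbit \<pi> ` ?S)"
    using inj by (simp add: inj_on_def inj_image_eq_iff)
  ultimately have "mset_set (orbit ?\<sigma> ` ?S) = image_mset ((`) \<rho>) (mset_set (orbit \<pi> ` ?S))"
    by (simp add: image_mset_mset_set)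
  moreover have "card (\<rho> ` C) = card C" for C
    using inj by (intro card_image) (rule inj_on_subset[OF _ subset_UNIV])
  ultimately show ?thesis
    by (simp add: cycle_type_def multiset.map_comp comp_def)
qed

lemma class_function_in_centre:
  assumes zero: "\<And>\<pi>. \<pi> \<notin> carrier (sym_group n) \<Longrightarrow> f \<pi> = 0"
    and conj: "\<And>\<pi> \<rho>. \<pi> \<in> carrier (sym_group n) \<Longrightarrow> \<rho> \<in> carrier (sym_group n) \<Longrightarrow>
      f (\<rho> \<circ> \<pi> \<circ> inv' \<rho>) = f \<pi>"
  shows "f \<in> centre (group_algebra (sym_group n))"
proof -
  let ?C = "carrier (sym_group n)"
  have facts: "z \<circ> (inv' z \<circ> y \<circ> z) \<circ> inv' z = y" "inv' z \<circ> y \<circ> z \<in> ?C" "z \<circ> (inv' z \<circ> y \<circ> z) = y \<circ> z"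
    "y \<circ> z \<circ> inv' z = y" "f (inv' z \<circ> y \<circ> z) = f y" if "y \<in> ?C" "z \<in> ?C" for y z
  proof -
    have yz: "y permutes {1..n}" "z permutes {1..n}" using that by (simp_all add: sym_group_carrier)
    have inv: "z \<circ> inv' z = id" by (rule permutes_inv_o(1)[OF yz(2)])
    then show 1: "z \<circ> (inv' z \<circ> y \<circ> z) = y \<circ> z" by (simp flip: comp_assoc)
    show "z \<circ> (inv' z \<circ> y \<circ> z) \<circ> inv' z = y" 
      unfolding comp_assoc[symmetric] inv by (simp add: comp_assoc inv)
    show "y \<circ> z \<circ> inv' z = y" by (simp add: comp_assoc inv)
    show "inv' z \<circ> y \<circ> z \<in> ?C" using yz by (simp add: sym_group_carrier permutes_compose permutes_inv)
    have "f (inv' z \<circ> y \<circ> inv' (inv' z)) = f y"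
      by (rule conj) (use yz in \<open>simp_all add: sym_group_carrier permutes_inv\<close>)
    then show "f (inv' z \<circ> y \<circ> z) = f y" by (simp only: permutes_inv_inv[OF yz(2)])
  qed
  have facts': "inv' y \<circ> (y \<circ> z \<circ> inv' y) \<circ> y = z" "y \<circ> z \<circ> inv' y \<in> ?C" "y \<circ> z \<circ> inv' y \<circ> y = y \<circ> z"
    if "y \<in> ?C" "z \<in> ?C" for y z
  proof -
    have yz: "y permutes {1..n}" "z permutes {1..n}" using that by (simp_all add: sym_group_carrier)
    have inv: "inv' y \<circ> y = id" by (rule permutes_inv_o(2)[OF yz(1)])
    then show 1: "y \<circ> z \<circ> inv' y \<circ> y = y \<circ> z" by (simp add: comp_assoc)
    show "inv' y \<circ> (y \<circ> z \<circ> inv' y) \<circ> y = z"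
      unfolding comp_assoc unfolding comp_assoc[symmetric] inv by (simp add: comp_assoc inv)
    show "y \<circ> z \<circ> inv' y \<in> ?C" using yz by (simp add: sym_group_carrier permutes_compose permutes_inv)
  qed
  have "(\<Sum>(y, z) \<in> {(y, z). y \<in> ?C \<and> z \<in> ?C \<and> y \<circ> z = x}. f y * a z) =
      (\<Sum>(y, z) \<in> {(y, z). y \<in> ?C \<and> z \<in> ?C \<and> y \<circ> z = x}. a y * f z)" for a x
    \<comment> \<open>The factorization \<open>y z\<close> is rewritten as
      \<open>z (z^-1 y z)\<close>, which has the same product; the class function \<open>f\<close>
      takes the same value at \<open>y\<close> and at its conjugate.\<close>
    by (rule sum.reindex_bij_witness[where
        i = "\<lambda>(y, z). (y \<circ> z \<circ> inv' y, y)" and j = "\<lambda>(y, z). (z, inv' z \<circ> y \<circ> z)"])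
      (clarsimp simp: facts facts')+
  then show ?thesis using zero by (simp add: centre_def group_algebra_def sym_group_mult)
qed

lemma trans_power_central:
  assumes "1 \<le> n"
  shows "trans_power n r \<in> centre (group_algebra (sym_group n))"
proof (rule class_function_in_centre)
  fix \<pi> assume "\<pi> \<notin> carrier (sym_group n)"
  then show "trans_power n r \<pi> = 0"
    by (simp add: trans_power_class_expansion[OF assms] class_sum_eq conj_class_def case_prod_unfold)
next
  fix \<pi> \<rho> assume "\<pi> \<in> carrier (sym_group n)" "\<rho> \<in> carrier (sym_group n)"
  then have "\<rho> \<circ> \<pi> \<circ> inv' \<rho> \<in> carrier (sym_group n) \<and> cycle_type n (\<rho> \<circ> \<pi> \<circ> inv' \<rho>) = cycle_type n \<pi>"
    unfolding sym_group_carrier using cycle_type_conj permutes_compose permutes_inv by metis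
  then show "trans_power n r (\<rho> \<circ> \<pi> \<circ> inv' \<rho>) = trans_power n r \<pi>"
    using \<open>\<pi> \<in> carrier (sym_group n)\<close>
    by (simp add: trans_power_class_expansion[OF assms] class_sum_eq conj_class_def)
qed

section \<open>Polynomiality\<close>

lemma mpoly_eval_superset:
  assumes "finite T" "Poly_Mapping.keys P \<subseteq> T"
  shows "mpoly_eval v P =
    (\<Sum>e \<in> T. Poly_Mapping.lookup P e * (\<Prod>i \<in> Poly_Mapping.keys e. v i ^ Poly_Mapping.lookup e i))"
  unfolding mpoly_eval_def using assms
  by (intro sum.mono_neutral_left) (auto simp: in_keys_iff)

lemma mpoly_eval_add: "mpoly_eval v (P + R) = mpoly_eval v P + mpoly_eval v R"
proof -
  let ?T = "Poly_Mapping.keys P \<union> Poly_Mapping.keys R"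
  have "Poly_Mapping.keys (P + R) \<subseteq> ?T" by (rule Poly_Mapping.keys_add)
  then show ?thesis
    by (simp add: mpoly_eval_superset[of ?T] lookup_add distrib_right sum.distrib)
qed

lemma mpoly_vars_add: "mpoly_vars (P + R) \<subseteq> mpoly_vars P \<union> mpoly_vars R"
  unfolding mpoly_vars_def using Poly_Mapping.keys_add[of P R] by blast

lemma mpoly_eval_single:
  "mpoly_eval v (Poly_Mapping.single e a) =
    a * (\<Prod>i \<in> Poly_Mapping.keys e. v i ^ Poly_Mapping.lookup e i)"
  by (simp add: mpoly_eval_superset[of "{e}"])

definition monomial_value :: "(nat \<Rightarrow>\<^sub>0 nat) \<Rightarrow> (nat \<Rightarrow> complex) \<Rightarrow> complex" where
  "monomial_value e v = (\<Prod>i \<in> Poly_Mapping.keys e. v i ^ Poly_Mapping.lookup e i)"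

lemma monomial_value_add: "monomial_value (e + f) v = monomial_value e v * monomial_value f v"
proof -
  let ?T = "Poly_Mapping.keys e \<union> Poly_Mapping.keys f"
  have sup: "monomial_value e' v = (\<Prod>i \<in> ?T. v i ^ Poly_Mapping.lookup e' i)"
    if "Poly_Mapping.keys e' \<subseteq> ?T" for e'
    unfolding monomial_value_def using that
    by (intro prod.mono_neutral_left) (auto simp: in_keys_iff)
  show ?thesis
    using Poly_Mapping.keys_add[of e f] by (simp add: sup lookup_add power_add prod.distrib)
qed

lemma polynomial_in_parts_cong:
  assumes "\<And>n \<alpha>. n \<ge> 1 \<Longrightarrow> \<alpha> \<in> partitions_of n \<Longrightarrow> length \<alpha> = m \<Longrightarrow> F \<alpha> = G \<alpha>"
  shows "polynomial_in_parts m F \<longleftrightarrow> polynomial_in_parts m G"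
  unfolding polynomial_in_parts_def using assms by metis

lemma polynomial_in_parts_add:
  assumes "polynomial_in_parts m F" "polynomial_in_parts m G"
  shows "polynomial_in_parts m (\<lambda>\<alpha>. F \<alpha> + G \<alpha>)"
proof -
  obtain P where P: "mpoly_vars P \<subseteq> {..<m}" "\<forall>n \<ge> 1. \<forall>\<alpha> \<in> partitions_of n. length \<alpha> = m \<longrightarrow>
           F \<alpha> = mpoly_eval (\<lambda>i. of_nat (\<alpha> ! i)) P"
    using assms(1) unfolding polynomial_in_parts_def by blast
  obtain R where R: "mpoly_vars R \<subseteq> {..<m}" "\<forall>n \<ge> 1. \<forall>\<alpha> \<in> partitions_of n. length \<alpha> = m \<longrightarrow>
           G \<alpha> = mpoly_eval (\<lambda>i. of_nat (\<alpha> ! i)) R"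
    using assms(2) unfolding polynomial_in_parts_def by blast
  show ?thesis unfolding polynomial_in_parts_def
    by (rule exI[of _ "P + R"]) (use P R mpoly_vars_add[of P R] in \<open>auto simp: mpoly_eval_add\<close>)
qed

lemma polynomial_in_parts_monomial:
  assumes "Poly_Mapping.keys e \<subseteq> {..<m}"
  shows "polynomial_in_parts m (\<lambda>\<alpha>. a * monomial_value e (\<lambda>i. of_nat (\<alpha> ! i)))"
  unfolding polynomial_in_parts_def
  by (rule exI[of _ "Poly_Mapping.single e a"])
    (use assms in \<open>auto simp: mpoly_eval_single monomial_value_def mpoly_vars_def split: if_splits\<close>)

lemma polynomial_in_parts_const: "polynomial_in_parts m (\<lambda>\<alpha>. a)"
  using polynomial_in_parts_monomial[of 0 m a] by (simp add: monomial_value_def)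

lemma polynomial_in_parts_part: "i < m \<Longrightarrow> polynomial_in_parts m (\<lambda>\<alpha>. of_nat (\<alpha> ! i))"
  using polynomial_in_parts_monomial[of "Poly_Mapping.single i 1" m 1] by (simp add: monomial_value_def)

lemma polynomial_in_parts_sum:
  assumes "\<And>x. x \<in> A \<Longrightarrow> polynomial_in_parts m (F x)"
  shows "polynomial_in_parts m (\<lambda>\<alpha>. \<Sum>x \<in> A. F x \<alpha>)"
  using assms
  by (induction A rule: infinite_finite_induct)
    (simp_all add: polynomial_in_parts_const polynomial_in_parts_add)

text \<open>The product of the two evaluations is expanded into a double sum of monomials, each of
  which is polynomial in the parts; so \<open>P * R\<close> never has to be evaluated.\<close>

lemma polynomial_in_parts_mult:
  assumes "polynomial_in_parts m F" "polynomial_in_parts m G"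
  shows "polynomial_in_parts m (\<lambda>\<alpha>. F \<alpha> * G \<alpha>)"
proof -
  obtain P where P: "mpoly_vars P \<subseteq> {..<m}" "\<And>n \<alpha>. n \<ge> 1 \<Longrightarrow> \<alpha> \<in> partitions_of n \<Longrightarrow> length \<alpha> = m \<Longrightarrow>
           F \<alpha> = mpoly_eval (\<lambda>i. of_nat (\<alpha> ! i)) P"
    using assms(1) unfolding polynomial_in_parts_def by blast
  obtain R where R: "mpoly_vars R \<subseteq> {..<m}" "\<And>n \<alpha>. n \<ge> 1 \<Longrightarrow> \<alpha> \<in> partitions_of n \<Longrightarrow> length \<alpha> = m \<Longrightarrow>
           G \<alpha> = mpoly_eval (\<lambda>i. of_nat (\<alpha> ! i)) R"
    using assms(2) unfolding polynomial_in_parts_def by blast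
  let ?H = "\<lambda>\<alpha>. \<Sum>e \<in> Poly_Mapping.keys P. \<Sum>f \<in> Poly_Mapping.keys R.
    (Poly_Mapping.lookup P e * Poly_Mapping.lookup R f) * monomial_value (e + f) (\<lambda>i. of_nat (\<alpha> ! i))"
  have "polynomial_in_parts m ?H"
  proof (intro polynomial_in_parts_sum polynomial_in_parts_monomial)
    fix e f assume "e \<in> Poly_Mapping.keys P" "f \<in> Poly_Mapping.keys R"
    then show "Poly_Mapping.keys (e + f) \<subseteq> {..<m}"
      using P(1) R(1) Poly_Mapping.keys_add[of e f] unfolding mpoly_vars_def by blast
  qed
  moreover have "F \<alpha> * G \<alpha> = ?H \<alpha>" if "n \<ge> 1" "\<alpha> \<in> partitions_of n" "length \<alpha> = m" for n \<alpha>
    using P(2)[OF that] R(2)[OF that]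
    by (simp add: mpoly_eval_def monomial_value_add sum_product mult_ac flip: monomial_value_def)
  ultimately show ?thesis using polynomial_in_parts_cong by (metis (no_types, lifting))
qed

lemma polynomial_in_parts_prod:
  assumes "\<And>x. x \<in> A \<Longrightarrow> polynomial_in_parts m (F x)"
  shows "polynomial_in_parts m (\<lambda>\<alpha>. \<Prod>x \<in> A. F x \<alpha>)"
  using assms
  by (induction A rule: infinite_finite_induct)
    (simp_all add: polynomial_in_parts_const polynomial_in_parts_mult)

lemma polynomial_in_parts_prod_list:
  assumes "\<And>x. x \<in> set xs \<Longrightarrow> polynomial_in_parts m (F x)"
  shows "polynomial_in_parts m (\<lambda>\<alpha>. \<Prod>x\<leftarrow>xs. F x \<alpha>)"
  using assms
  by (induction xs) (simp_all add: polynomial_in_parts_const polynomial_in_parts_mult)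

lemma polynomial_in_parts_power_sum: "polynomial_in_parts m (power_sum k)"
proof -
  \<comment> \<open>Powers are written as products of \<open>k\<close> equal factors to fit the
    closure rules.\<close>
  have "polynomial_in_parts m (\<lambda>\<alpha>. \<Sum>i < m. \<Prod>j < k. of_nat (\<alpha> ! i))"
    by (intro polynomial_in_parts_sum polynomial_in_parts_prod polynomial_in_parts_part) simp
  moreover have "power_sum k \<alpha> = (\<Sum>i < m. \<Prod>j < k. of_nat (\<alpha> ! i))" if "length \<alpha> = m" for \<alpha>
    using that by (simp add: power_sum_def sum_list_sum_nth lessThan_atLeast0)
  ultimately show ?thesis using polynomial_in_parts_cong by (metis (no_types, lifting))
qed

lemma polynomial_in_parts_Q: "polynomial_in_parts m (Q g)"
proof -
  have "polynomial_in_parts m (\<lambda>\<alpha>. q k \<alpha>)" for k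
    unfolding q_def diff_conv_add_uminus
    by (intro polynomial_in_parts_add polynomial_in_parts_power_sum polynomial_in_parts_const)
  then have "polynomial_in_parts m (\<lambda>\<alpha>. Q g \<alpha>)"
    unfolding Q_def divide_inverse
    by (intro polynomial_in_parts_sum polynomial_in_parts_mult polynomial_in_parts_prod_list
        polynomial_in_parts_const)
  then show ?thesis .
qed

text \<open>For fixed \<open>k\<close> this exhibits the quotient of factorials as a polynomial in
  \<open>n\<close>.\<close>

lemma fact_add_over_fact: "fact (n + k) / fact n = (\<Prod>j < k. of_nat (n + Suc j) :: complex)"
  by (induction k) (simp_all add: field_simps)

text \<open>With \<open>k = m + 2 * g - 2\<close> the quotient of factorials is
  \<open>(n + k)! / n!\<close>, a polynomial in \<open>n = p_1\<close> unless \<open>k\<close> would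
  be negative. The first two cases deal with these exceptions.\<close>

lemma polynomial_in_parts_coeff_a: "polynomial_in_parts m (coeff_a g)"
proof -
  consider "m = 0" | "m = 1" "g = 0" | "2 \<le> m + 2 * g" "0 < m" by linarith
  then show ?thesis
  proof cases
    case 1
    \<comment> \<open>Vacuous, since a partition of a positive number has a part.\<close>
    have "coeff_a g \<alpha> = 0" if "n \<ge> 1" "\<alpha> \<in> partitions_of n" "length \<alpha> = m" for n \<alpha>
      using that 1 by (simp add: partitions_of_def)
    then show ?thesis using polynomial_in_parts_const[of m 0] polynomial_in_parts_cong by metis
  next
    case 2
    \<comment> \<open>Here the quotient \<open>(n - 1)! / n!\<close> is \<open>1 / n\<close> and
      cancels against the only part \<open>n\<close>.\<close>
    have "coeff_a g \<alpha> = 1" if "n \<ge> 1" "\<alpha> \<in> partitions_of n" "length \<alpha> = m" for n \<alpha>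
    proof -
      have "\<alpha> = [n]" using that 2 by (cases \<alpha>) (auto simp: partitions_of_def)
      moreover have "(of_nat n :: complex) * fact (n - 1) = fact n"
        using that(1) by (simp add: fact_reduce)
      ultimately show ?thesis
        using that(1) by (simp add: coeff_a_def 2 Q_eq_partition_sum partition_sum_0 mult.commute)
    qed
    then show ?thesis using polynomial_in_parts_const[of m 1] polynomial_in_parts_cong by metis
  next
    case 3
    define k where "k = m + 2 * g - 2"
    let ?H = "\<lambda>\<alpha>. (\<Prod>j < k. power_sum 1 \<alpha> + of_nat (Suc j)) * (\<Prod>i < m. of_nat (\<alpha> ! i)) * Q g \<alpha>"
    have "polynomial_in_parts m ?H"
      by (intro polynomial_in_parts_mult polynomial_in_parts_prod polynomial_in_parts_add
          polynomial_in_parts_const polynomial_in_parts_part polynomial_in_parts_Q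
          polynomial_in_parts_power_sum) simp
    moreover have "coeff_a g \<alpha> = ?H \<alpha>" if "length \<alpha> = m" for \<alpha>
    proof -
      have "sum_list \<alpha> + length \<alpha> + 2 * g - 2 = sum_list \<alpha> + k" using 3 that by (simp add: k_def)
      moreover have "power_sum 1 \<alpha> = of_nat (sum_list \<alpha>)"
        by (induction \<alpha>) (simp_all add: power_sum_def)
      moreover have "(\<Prod>a\<leftarrow>\<alpha>. of_nat a) = (\<Prod>i < m. of_nat (\<alpha> ! i) :: complex)"
        using that by (simp add: prod.list_conv_set_nth lessThan_atLeast0)
      ultimately show ?thesis by (simp only: coeff_a_def fact_add_over_fact of_nat_add)
    qed
    ultimately show ?thesis using polynomial_in_parts_cong[of m "coeff_a g" ?H] by blast
  qed
qed

theorem theorem1p1: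
  shows "(\<forall>n \<ge> 1. \<forall>r.
            trans_power n r \<in> centre (group_algebra (sym_group n)) \<and>
            trans_power n r =
              (\<lambda>\<pi>. \<Sum>(\<alpha>, g) \<in> {(\<alpha>, g). \<alpha> \<in> partitions_of n \<and> n + length \<alpha> + 2 * g = r + 2}.
                      coeff_a g \<alpha> * class_sum n \<alpha> \<pi>)) \<and>
         (\<forall>g m. polynomial_in_parts m (coeff_a g))"
  using trans_power_central trans_power_class_expansion polynomial_in_parts_coeff_a by blast

end
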